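(* Let $S$ be a Boolean inverse monoid. Then $S$ has finitely many idempotent elements if and only if it is isomorphic to a finite product of fully group-matricial Boolean inverse semigroups.
   Context: A semigroup $S$ is inverse if every $x\in S$ has a unique $x^{-1}$ with $x=xx^{-1}x$ and $x^{-1}=x^{-1}xx^{-1}$. The natural ordering is $x\le y$ iff $x=yx^{-1}x$. In an inverse semigroup with zero, $x,y$ are orthogonal if $x^{-1}y=xy^{-1}=0$. A Boolean inverse semigroup is an inverse semigroup $S$ with zero whose idempotents form a generalized Boolean algebra and in which any two orthogonal $x,y$ have a join $x\oplus y$ for the natural ordering; a Boolean inverse monoid is a unital Boolean inverse semigroup. For a positive integer $n$ and a Boolean inverse semigroup $S$, a generalized rook matrix of order $n$ over $S$ is a matrix $(x_{i,j})_{1\le i,j\le n}$ over $S$ with $x_{i,j}^{-1}x_{i,k}=x_{j,i}x_{k,i}^{-1}=0$ whenever $j\ne k$; these form a Boolean inverse semigroup $\mathrm M^{\oplus}_n(S)$ under $(xy)_{i,j}=\bigoplus_kx_{i,k}y_{k,j}$. For a group $G$, $G^{\sqcup0}=G\cup\{0\}$ is $G$ with a new zero element. A Boolean inverse monoid is fully group-matricial if it is isomorphic to $\mathrm M^{\oplus}_n(G^{\sqcup0})$ for some positive integer $n$ and some group $G$. The empty product, i.e. the one-element monoid, counts as a finite product. *)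

theory Defs
  imports
    "HOL-Algebra.Group"
    "HOL-Algebra.Product_Groups"
    "Jordan_Normal_Form.Matrix"
begin

text \<open>
  Semigroups are rendered by the monoid records of HOL-Algebra. For structures that need not
  have a unit, the field \<open>one\<close> is simply ignored.
\<close>

locale inverse_semigroup =
  fixes S :: "('a, 'm) monoid_scheme" (structure)
  assumes mult_closed: "\<lbrakk>x \<in> carrier S; y \<in> carrier S\<rbrakk> \<Longrightarrow> x \<otimes> y \<in> carrier S"
    and mult_assoc:
      "\<lbrakk>x \<in> carrier S; y \<in> carrier S; z \<in> carrier S\<rbrakk> \<Longrightarrow> (x \<otimes> y) \<otimes> z = x \<otimes> (y \<otimes> z)"
    and unique_inverse:
      "x \<in> carrier S \<Longrightarrow> \<exists>!y. y \<in> carrier S \<and> x = x \<otimes> y \<otimes> x \<and> y = y \<otimes> x \<otimes> y"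

definition semigroup_inv :: "('a, 'm) monoid_scheme \<Rightarrow> 'a \<Rightarrow> 'a" where
  "semigroup_inv S x =
    (THE y. y \<in> carrier S \<and> x = x \<otimes>\<^bsub>S\<^esub> y \<otimes>\<^bsub>S\<^esub> x \<and> y = y \<otimes>\<^bsub>S\<^esub> x \<otimes>\<^bsub>S\<^esub> y)"

definition idempotents :: "('a, 'm) monoid_scheme \<Rightarrow> 'a set" where
  "idempotents S = {e \<in> carrier S. e \<otimes>\<^bsub>S\<^esub> e = e}"

definition natural_order :: "('a, 'm) monoid_scheme \<Rightarrow> 'a gorder" where
  "natural_order S =
    \<lparr>carrier = carrier S, eq = (=), le = (\<lambda>x y. x = y \<otimes>\<^bsub>S\<^esub> semigroup_inv S x \<otimes>\<^bsub>S\<^esub> x)\<rparr>"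

definition is_zero :: "('a, 'm) monoid_scheme \<Rightarrow> 'a \<Rightarrow> bool" where
  "is_zero S z \<longleftrightarrow> z \<in> carrier S \<and> (\<forall>x \<in> carrier S. z \<otimes>\<^bsub>S\<^esub> x = z \<and> x \<otimes>\<^bsub>S\<^esub> z = z)"

definition semigroup_zero :: "('a, 'm) monoid_scheme \<Rightarrow> 'a" where
  "semigroup_zero S = (THE z. is_zero S z)"

definition orthogonal :: "('a, 'm) monoid_scheme \<Rightarrow> 'a \<Rightarrow> 'a \<Rightarrow> bool" where
  "orthogonal S x y \<longleftrightarrow>
    semigroup_inv S x \<otimes>\<^bsub>S\<^esub> y = semigroup_zero S \<and> x \<otimes>\<^bsub>S\<^esub> semigroup_inv S y = semigroup_zero S"

text \<open>
  A generalized Boolean algebra is a distributive lattice with a least element (and not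
  necessarily a greatest one) that is sectionally complemented.
\<close>

locale generalized_boolean_algebra =
  Lattice.lattice L + weak_partial_order_bottom L for L (structure) +
  assumes meet_join_distrib:
      "\<lbrakk>x \<in> carrier L; y \<in> carrier L; z \<in> carrier L\<rbrakk>
        \<Longrightarrow> x \<sqinter> (y \<squnion> z) = (x \<sqinter> y) \<squnion> (x \<sqinter> z)"
    and sectionally_complemented:
      "\<lbrakk>x \<in> carrier L; y \<in> carrier L; x \<sqsubseteq> y\<rbrakk>
        \<Longrightarrow> \<exists>z \<in> carrier L. x \<sqinter> z = \<bottom> \<and> x \<squnion> z = y"

locale boolean_inverse_semigroup = inverse_semigroup +
  assumes zero_exists: "\<exists>z. is_zero S z"
    and idempotents_generalized_boolean_algebra:
      "generalized_boolean_algebra ((natural_order S)\<lparr>carrier := idempotents S\<rparr>)"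
    and orthogonal_join_exists:
      "\<lbrakk>x \<in> carrier S; y \<in> carrier S; orthogonal S x y\<rbrakk>
        \<Longrightarrow> \<exists>s. least (natural_order S) s (Upper (natural_order S) {x, y})"

locale boolean_inverse_monoid = boolean_inverse_semigroup S + Group.monoid S
  for S (structure)

text \<open>
  Matrix entries are indexed from 0. The finite orthogonal join in the product is the supremum,
  for the natural order, of the set of its terms; repetitions are harmless because an element
  that is orthogonal to itself is zero. The field \<open>one\<close> is meaningful only if \<open>S\<close> is a monoid.
\<close>

definition rook_matrices :: "nat \<Rightarrow> ('a, 'm) monoid_scheme \<Rightarrow> 'a mat monoid" where
  "rook_matrices n S =
    \<lparr>carrier = {x \<in> carrier_mat n n.
       (\<forall>i<n. \<forall>j<n. x $$ (i, j) \<in> carrier S) \<and>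
       (\<forall>i<n. \<forall>j<n. \<forall>k<n. j \<noteq> k \<longrightarrow>
          semigroup_inv S (x $$ (i, j)) \<otimes>\<^bsub>S\<^esub> x $$ (i, k) = semigroup_zero S \<and>
          x $$ (j, i) \<otimes>\<^bsub>S\<^esub> semigroup_inv S (x $$ (k, i)) = semigroup_zero S)},
     monoid.mult = (\<lambda>x y. mat n n (\<lambda>(i, j).
       \<Squnion>\<^bsub>natural_order S\<^esub> {x $$ (i, k) \<otimes>\<^bsub>S\<^esub> y $$ (k, j) | k. k < n})),
     one = mat n n (\<lambda>(i, j). if i = j then \<one>\<^bsub>S\<^esub> else semigroup_zero S)\<rparr>"

definition adjoin_zero :: "('g, 'm) monoid_scheme \<Rightarrow> 'g option monoid" where
  "adjoin_zero G =
    \<lparr>carrier = insert None (Some ` carrier G),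
     monoid.mult = (\<lambda>x y. case (x, y) of (Some g, Some h) \<Rightarrow> Some (g \<otimes>\<^bsub>G\<^esub> h) | _ \<Rightarrow> None),
     one = Some \<one>\<^bsub>G\<^esub>\<rparr>"

text \<open>
  The type argument is the type over which the group \<open>G\<close> is sought. The choice \<open>TYPE('a)\<close> loses
  nothing: as \<open>n > 0\<close>, the group embeds into the carrier of \<open>M\<close>, so that it has an isomorphic copy
  over \<open>'a\<close>.
\<close>

definition fully_group_matricial :: "'g itself \<Rightarrow> ('a, 'm) monoid_scheme \<Rightarrow> bool" where
  "fully_group_matricial (_ :: 'g itself) M \<longleftrightarrow>
    boolean_inverse_monoid M \<and>
    (\<exists>n > 0. \<exists>G :: 'g monoid. group G \<and> M \<cong> rook_matrices n (adjoin_zero G))"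

text \<open>
  \<open>product_group\<close> is the componentwise product of arbitrary monoid records; for the empty index
  set it has exactly one element.
\<close>

definition finite_product_of_fully_group_matricial ::
    "'b itself \<Rightarrow> 'g itself \<Rightarrow> ('a, 'm) monoid_scheme \<Rightarrow> bool" where
  "finite_product_of_fully_group_matricial (_ :: 'b itself) (_ :: 'g itself) S \<longleftrightarrow>
    (\<exists>(k :: nat) (T :: nat \<Rightarrow> 'b monoid).
      (\<forall>i<k. fully_group_matricial TYPE('g) (T i)) \<and> S \<cong> product_group {..<k} T)"

end

theory Submission
  imports Defs
begin

text \<open>
  Both directions rest on the atoms of the Boolean algebra of idempotents.

  Suppose that \<open>S\<close> has finitely many idempotents. An element \<open>x\<close> is determined by its restrictions
  \<open>x \<otimes> a\<close> to the atoms \<open>a\<close> (\<open>eq_if_atoms\<close>), and every family of elements with the atoms as domains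
  and with pairwise orthogonal ranges consists of the restrictions of some element (\<open>glue_atoms\<close>).
  A restriction \<open>x \<otimes> a\<close> that is not zero takes \<open>a\<close> to an atom \<open>b\<close>, its range idempotent. So \<open>x\<close>
  is a partial bijection of the set of atoms together with an element from \<open>a\<close> to \<open>b\<close> for each
  pair \<open>(a, b)\<close> of its graph, and this is almost the description of a rook matrix.

  Call two atoms related if some element has one as its domain and the other as its range. The
  join of the atoms of a class is a central idempotent \<open>e\<close> (\<open>class_idem\<close>), because \<open>x \<otimes> a\<close> takes \<open>a\<close> to
  an atom of the same class. The elements \<open>e \<otimes> x\<close>, with \<open>e\<close> ranging over these finitely many idempotents,
  determine \<open>x\<close> and can be prescribed independently, so \<open>S\<close> is the product of the corners
  \<open>e \<otimes> S \<otimes> e\<close>. Each corner is a Boolean inverse monoid (\<open>boolean_inverse_monoid_corner\<close>) in which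
  any two atoms are related.

  If any two atoms are related, choose an atom \<open>u\<close> and for every atom \<open>c i\<close> an element \<open>p i\<close>
  from \<open>u\<close> to \<open>c i\<close>. Then \<open>(p i)\<^sup>\<star> \<otimes> x \<otimes> p j\<close> is zero or belongs to the group \<open>G\<close> of the elements
  whose domain and range are \<open>u\<close>, and these entries identify \<open>S\<close> with the rook matrices over \<open>G\<close>
  with a zero (\<open>iso_rook_matrices\<close>).

  Conversely, an idempotent rook matrix over a group with zero has only entries \<open>0\<close> and \<open>1\<close>
  (\<open>rook_idempotent_entry\<close>), so there are finitely many of them, and the idempotents of a product
  are the families of idempotents of its factors.
\<close>

section \<open>Inverse semigroups\<close>

context inverse_semigroup
begin

abbreviation sinv :: "'a \<Rightarrow> 'a" ("_\<^sup>\<star>" [1000] 1000) where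
  "x\<^sup>\<star> \<equiv> semigroup_inv S x"

abbreviation nat_le :: "'a \<Rightarrow> 'a \<Rightarrow> bool" (infix "\<preceq>" 50) where
  "x \<preceq> y \<equiv> x \<sqsubseteq>\<^bsub>natural_order S\<^esub> y"

abbreviation E :: "'a set" where
  "E \<equiv> idempotents S"

lemmas [simp] = mult_closed

lemma sinv_props:
  assumes "x \<in> carrier S"
  shows sinv_closed [simp]: "x\<^sup>\<star> \<in> carrier S"
    and mult_sinv_mult: "x \<otimes> x\<^sup>\<star> \<otimes> x = x"
    and sinv_mult_sinv: "x\<^sup>\<star> \<otimes> x \<otimes> x\<^sup>\<star> = x\<^sup>\<star>"
  using theI'[OF unique_inverse[OF assms]] unfolding semigroup_inv_def by auto

lemma sinv_unique:
  "\<lbrakk>x \<in> carrier S; y \<in> carrier S; x \<otimes> y \<otimes> x = x; y \<otimes> x \<otimes> y = y\<rbrakk> \<Longrightarrow> x\<^sup>\<star> = y"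
  using unique_inverse[of x] sinv_props[of x] by metis

lemma sinv_sinv [simp]: "x \<in> carrier S \<Longrightarrow> x\<^sup>\<star>\<^sup>\<star> = x"
  by (intro sinv_unique) (auto simp: sinv_props)

lemma idemI: "\<lbrakk>x \<in> carrier S; x \<otimes> x = x\<rbrakk> \<Longrightarrow> x \<in> E"
  and idem_closed [simp]: "e \<in> E \<Longrightarrow> e \<in> carrier S"
  and idem_idem [simp]: "e \<in> E \<Longrightarrow> e \<otimes> e = e"
  by (auto simp: idempotents_def)

lemma idem_sinv [simp]: "e \<in> E \<Longrightarrow> e\<^sup>\<star> = e"
  by (intro sinv_unique) auto

lemma idem_cancel_left: "\<lbrakk>e \<in> E; x \<in> carrier S\<rbrakk> \<Longrightarrow> e \<otimes> (e \<otimes> x) = e \<otimes> x"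
  by (simp flip: mult_assoc)

lemma absorb_trans:
  "\<lbrakk>e \<in> carrier S; f \<in> carrier S; x \<in> carrier S; e \<otimes> f = f; f \<otimes> x = x\<rbrakk> \<Longrightarrow> e \<otimes> x = x"
  by (metis mult_assoc)

lemma sinv_cancel:
  assumes "x \<in> carrier S"
  shows "x \<otimes> (x\<^sup>\<star> \<otimes> x) = x" "x\<^sup>\<star> \<otimes> (x \<otimes> x\<^sup>\<star>) = x\<^sup>\<star>"
    and "y \<in> carrier S \<Longrightarrow> x \<otimes> (x\<^sup>\<star> \<otimes> (x \<otimes> y)) = x \<otimes> y"
    and "y \<in> carrier S \<Longrightarrow> x\<^sup>\<star> \<otimes> (x \<otimes> (x\<^sup>\<star> \<otimes> y)) = x\<^sup>\<star> \<otimes> y"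
  using assms by (simp_all add: sinv_props flip: mult_assoc)

lemmas normal_simps = mult_assoc idem_cancel_left sinv_cancel

text \<open>
  If \<open>x\<close> is the inverse of \<open>e \<otimes> f\<close> then so is \<open>f \<otimes> x \<otimes> e\<close>; uniqueness makes \<open>x\<close> idempotent,
  hence equal to its own inverse \<open>e \<otimes> f\<close>.
\<close>

lemma idem_mult_closed [simp]:
  assumes e: "e \<in> E" and f: "f \<in> E"
  shows "e \<otimes> f \<in> E"
proof -
  define x where "x = (e \<otimes> f)\<^sup>\<star>"
  have c [simp]: "e \<in> carrier S" "f \<in> carrier S" "x \<in> carrier S"
    using e f by (auto simp: x_def)
  have 1: "e \<otimes> (f \<otimes> (x \<otimes> (e \<otimes> f))) = e \<otimes> f"
    using sinv_props(2)[of "e \<otimes> f"] by (simp add: x_def mult_assoc)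
  have inv_eq: "x \<otimes> (e \<otimes> (f \<otimes> x)) = x"
    using sinv_props(3)[of "e \<otimes> f"] by (simp add: x_def mult_assoc)
  have inv_eq_ext: "x \<otimes> (e \<otimes> (f \<otimes> (x \<otimes> z))) = x \<otimes> z" if "z \<in> carrier S" for z
    using arg_cong[OF inv_eq, of "\<lambda>u. u \<otimes> z"] that by (simp add: mult_assoc)
  have "(e \<otimes> f)\<^sup>\<star> = f \<otimes> (x \<otimes> e)"
    using e f by (intro sinv_unique) (simp_all add: mult_assoc idem_cancel_left 1 inv_eq_ext)
  then have x: "f \<otimes> (x \<otimes> e) = x"
    by (simp only: x_def)
  have "(f \<otimes> (x \<otimes> e)) \<otimes> (f \<otimes> (x \<otimes> e)) = f \<otimes> (x \<otimes> e)"
    by (simp add: mult_assoc inv_eq_ext)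
  then have "x \<otimes> x = x"
    by (simp only: x)
  then have "x \<in> E"
    by (intro idemI) simp_all
  moreover have "e \<otimes> f = x\<^sup>\<star>"
    by (simp add: x_def)
  ultimately show ?thesis
    by simp
qed

text \<open>
  Both products are idempotent, so that \<open>e \<otimes> f\<close> and \<open>f \<otimes> e\<close> are two inverses of \<open>e \<otimes> f\<close>.
\<close>

lemma idem_commute:
  assumes e: "e \<in> E" and f: "f \<in> E"
  shows "e \<otimes> f = f \<otimes> e"
proof -
  have *: "e \<otimes> (f \<otimes> (e \<otimes> f)) = e \<otimes> f" "f \<otimes> (e \<otimes> (f \<otimes> e)) = f \<otimes> e"
    using idem_idem[OF idem_mult_closed[OF e f]] idem_idem[OF idem_mult_closed[OF f e]] e f
    by (simp_all add: mult_assoc del: idem_idem)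
  have "(e \<otimes> f)\<^sup>\<star> = f \<otimes> e"
    using e f by (intro sinv_unique) (simp_all add: mult_assoc idem_cancel_left *)
  then show ?thesis
    using e f by simp
qed

lemma idem_left_commute:
  "\<lbrakk>e \<in> E; f \<in> E; x \<in> carrier S\<rbrakk> \<Longrightarrow> e \<otimes> (f \<otimes> x) = f \<otimes> (e \<otimes> x)"
  using idem_commute[of e f] by (simp flip: mult_assoc)

lemma dom_idem [simp]: "x \<in> carrier S \<Longrightarrow> x\<^sup>\<star> \<otimes> x \<in> E"
  by (rule idemI) (simp_all add: normal_simps)

lemma ran_idem [simp]: "x \<in> carrier S \<Longrightarrow> x \<otimes> x\<^sup>\<star> \<in> E"
  by (rule idemI) (simp_all add: normal_simps)

text \<open>
  The two idempotents \<open>x\<^sup>\<star> \<otimes> x\<close> and \<open>y \<otimes> y\<^sup>\<star>\<close> in the middle commute, after which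
  everything cancels.
\<close>

lemma sinv_mult:
  assumes x: "x \<in> carrier S" and y: "y \<in> carrier S"
  shows "(x \<otimes> y)\<^sup>\<star> = y\<^sup>\<star> \<otimes> x\<^sup>\<star>"
proof (intro sinv_unique)
  have comm: "y \<otimes> (y\<^sup>\<star> \<otimes> (x\<^sup>\<star> \<otimes> (x \<otimes> z))) = x\<^sup>\<star> \<otimes> (x \<otimes> (y \<otimes> (y\<^sup>\<star> \<otimes> z)))"
    if "z \<in> carrier S" for z
    using idem_left_commute[of "y \<otimes> y\<^sup>\<star>" "x\<^sup>\<star> \<otimes> x" z] x y that by (simp add: mult_assoc)
  show "x \<otimes> y \<otimes> (y\<^sup>\<star> \<otimes> x\<^sup>\<star>) \<otimes> (x \<otimes> y) = x \<otimes> y"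
    using x y by (simp add: normal_simps comm)
  show "y\<^sup>\<star> \<otimes> x\<^sup>\<star> \<otimes> (x \<otimes> y) \<otimes> (y\<^sup>\<star> \<otimes> x\<^sup>\<star>) = y\<^sup>\<star> \<otimes> x\<^sup>\<star>"
    using x y by (simp add: normal_simps flip: comm)
qed (use x y in auto)

lemma conj_idem [simp]: "\<lbrakk>x \<in> carrier S; e \<in> E\<rbrakk> \<Longrightarrow> x \<otimes> (e \<otimes> x\<^sup>\<star>) \<in> E"
  using ran_idem[of "x \<otimes> e"] by (simp add: sinv_mult normal_simps)

lemma mult_idem_conj:
  assumes x: "x \<in> carrier S" and e: "e \<in> E"
  shows "x \<otimes> e = x \<otimes> (e \<otimes> (x\<^sup>\<star> \<otimes> x))"
  using idem_commute[OF e dom_idem[OF x]] x e by (simp add: normal_simps)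

lemma le_iff: "\<lbrakk>x \<in> carrier S; y \<in> carrier S\<rbrakk> \<Longrightarrow> x \<preceq> y \<longleftrightarrow> y \<otimes> (x\<^sup>\<star> \<otimes> x) = x"
  by (auto simp: natural_order_def mult_assoc)

lemma idem_le_iff: "\<lbrakk>e \<in> E; y \<in> carrier S\<rbrakk> \<Longrightarrow> e \<preceq> y \<longleftrightarrow> y \<otimes> e = e"
  by (simp add: le_iff)

lemma mult_idem_le: "\<lbrakk>x \<in> carrier S; e \<in> E\<rbrakk> \<Longrightarrow> x \<otimes> e \<preceq> x"
  using idem_left_commute[of e "x\<^sup>\<star> \<otimes> x" e] by (simp add: le_iff sinv_mult normal_simps)


lemma le_refl: "x \<in> carrier S \<Longrightarrow> x \<preceq> x"
  by (simp add: le_iff normal_simps)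

lemma le_antisym:
  assumes "x \<preceq> y" "y \<preceq> x" and c: "x \<in> carrier S" "y \<in> carrier S"
  shows "x = y"
proof -
  define d e where "d = x\<^sup>\<star> \<otimes> x" and "e = y\<^sup>\<star> \<otimes> y"
  have [simp]: "d \<in> E" "e \<in> E"
    using c by (auto simp: d_def e_def)
  have x: "y \<otimes> d = x" "x \<otimes> d = x" and y: "x \<otimes> e = y"
    using assms by (auto simp: le_iff d_def e_def normal_simps)
  have "y \<otimes> d = (x \<otimes> e) \<otimes> d"
    by (simp only: y)
  also have "\<dots> = x \<otimes> (d \<otimes> e)"
    using c by (simp add: mult_assoc idem_commute)
  also have "\<dots> = y"
    using c x y by (simp flip: mult_assoc)
  finally show ?thesis
    using x by simp
qed

lemma le_trans:
  assumes "x \<preceq> y" "y \<preceq> z" and c: "x \<in> carrier S" "y \<in> carrier S" "z \<in> carrier S"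
  shows "x \<preceq> z"
proof -
  have "x = z \<otimes> ((y\<^sup>\<star> \<otimes> y) \<otimes> (x\<^sup>\<star> \<otimes> x))"
    using assms by (simp add: le_iff flip: mult_assoc)
  then show ?thesis
    using mult_idem_le[of z "(y\<^sup>\<star> \<otimes> y) \<otimes> (x\<^sup>\<star> \<otimes> x)"] c by simp
qed

text \<open>
  As idempotents commute, it is the same to cut \<open>y\<close> down to a smaller domain or to the
  corresponding smaller range. Hence the natural order is invariant under inversion.
\<close>

lemma le_iff_left:
  assumes x: "x \<in> carrier S" and y: "y \<in> carrier S"
  shows "x \<preceq> y \<longleftrightarrow> (x \<otimes> x\<^sup>\<star>) \<otimes> y = x"
proof
  define d where "d = x\<^sup>\<star> \<otimes> x"
  have d [simp]: "d \<in> E"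
    using x by (simp add: d_def)
  assume "x \<preceq> y"
  then have yd: "x = y \<otimes> d"
    using x y by (simp add: le_iff d_def)
  have "(x \<otimes> x\<^sup>\<star>) \<otimes> y = y \<otimes> (d \<otimes> (y\<^sup>\<star> \<otimes> y))"
    using y by (simp add: yd sinv_mult normal_simps)
  also have "\<dots> = y \<otimes> d"
    using mult_idem_conj[OF y d] by simp
  finally show "(x \<otimes> x\<^sup>\<star>) \<otimes> y = x"
    by (simp add: yd)
next
  define r where "r = x \<otimes> x\<^sup>\<star>"
  have r [simp]: "r \<in> E"
    using x by (simp add: r_def)
  assume "(x \<otimes> x\<^sup>\<star>) \<otimes> y = x"
  then have ry: "x = r \<otimes> y"
    by (simp add: r_def)
  have "y \<otimes> (x\<^sup>\<star> \<otimes> x) = (y \<otimes> y\<^sup>\<star>) \<otimes> (r \<otimes> y)"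
    using y by (simp add: ry sinv_mult normal_simps)
  also have "\<dots> = r \<otimes> y"
    using y idem_left_commute[of "y \<otimes> y\<^sup>\<star>" r y] by (simp add: normal_simps)
  finally show "x \<preceq> y"
    using x y by (simp add: le_iff ry)
qed

lemma le_sinv:
  assumes c: "x \<in> carrier S" "y \<in> carrier S" and "x \<preceq> y"
  shows "x\<^sup>\<star> \<preceq> y\<^sup>\<star>"
proof -
  have "((x \<otimes> x\<^sup>\<star>) \<otimes> y)\<^sup>\<star> = x\<^sup>\<star>"
    using assms by (simp add: le_iff_left)
  then show ?thesis
    using c by (simp add: le_iff sinv_mult)
qed

text \<open>
  Suprema in the Boolean algebra of idempotents, stated by multiplication alone (\<open>h \<otimes> e = e\<close>
  means \<open>e \<preceq> h\<close>).
\<close>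

definition idem_join :: "'a \<Rightarrow> 'a \<Rightarrow> 'a \<Rightarrow> bool" where
  "idem_join e f j \<longleftrightarrow> j \<in> E \<and> j \<otimes> e = e \<and> j \<otimes> f = f \<and>
     (\<forall>h\<in>E. h \<otimes> e = e \<longrightarrow> h \<otimes> f = f \<longrightarrow> h \<otimes> j = j)"

abbreviation idem_order :: "'a gorder" where
  "idem_order \<equiv> (natural_order S)\<lparr>carrier := E\<rparr>"

lemma natural_order_sel [simp]:
  "carrier (natural_order S) = carrier S" "eq (natural_order S) = (=)"
  by (simp_all add: natural_order_def)

lemma partial_order_idem_order: "partial_order idem_order"
  by unfold_locales (auto intro: le_refl le_antisym[OF _ _ idem_closed idem_closed]
      le_trans[OF _ _ idem_closed idem_closed idem_closed])

lemma least_Upper_idem_order_iff: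
  assumes "e \<in> E" "f \<in> E"
  shows "least idem_order j (Upper idem_order {e, f}) \<longleftrightarrow> idem_join e f j"
  using assms by (auto simp: least_def Upper_def idem_join_def idem_le_iff)

lemma greatest_Lower_idem_order_iff:
  assumes e: "e \<in> E" and f: "f \<in> E"
  shows "greatest idem_order m (Lower idem_order {e, f}) \<longleftrightarrow> m = e \<otimes> f"
proof -
  interpret partial_order idem_order
    by (rule partial_order_idem_order)
  have "greatest idem_order (e \<otimes> f) (Lower idem_order {e, f})"
    using e f idem_left_commute[of f e f]
    by (auto simp: greatest_def Lower_def idem_le_iff normal_simps)
  then show ?thesis
    using greatest_unique by auto
qed

end

section \<open>Semigroups with zero and their idempotents\<close>

locale inverse_semigroup_with_zero = inverse_semigroup +
  assumes zero_exists: "\<exists>z. is_zero S z"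
begin

abbreviation szero :: 'a ("\<^bold>0") where
  "\<^bold>0 \<equiv> semigroup_zero S"

lemma is_zero_semigroup_zero: "is_zero S \<^bold>0"
proof -
  obtain z where "is_zero S z"
    using zero_exists by blast
  moreover have "y = z" if "is_zero S y" for y
    using that \<open>is_zero S z\<close> by (metis is_zero_def)
  ultimately show ?thesis
    unfolding semigroup_zero_def by (rule theI)
qed

lemma zero_closed [simp]: "\<^bold>0 \<in> carrier S"
  and zero_mult [simp]: "x \<in> carrier S \<Longrightarrow> \<^bold>0 \<otimes> x = \<^bold>0"
  and mult_zero [simp]: "x \<in> carrier S \<Longrightarrow> x \<otimes> \<^bold>0 = \<^bold>0"
  using is_zero_semigroup_zero by (auto simp: is_zero_def)

lemma semigroup_zeroI: "is_zero S z \<Longrightarrow> \<^bold>0 = z"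
  using is_zero_semigroup_zero by (metis is_zero_def)

lemma zero_idem [simp]: "\<^bold>0 \<in> E"
  by (rule idemI) simp_all

lemma mult_sinv_eq_zero_iff:
  assumes x: "x \<in> carrier S" and y: "y \<in> carrier S"
  shows "x \<otimes> y = \<^bold>0 \<longleftrightarrow> (x\<^sup>\<star> \<otimes> x) \<otimes> y = \<^bold>0"
proof
  assume "(x\<^sup>\<star> \<otimes> x) \<otimes> y = \<^bold>0"
  then have "x \<otimes> ((x\<^sup>\<star> \<otimes> x) \<otimes> y) = \<^bold>0"
    using x by simp
  then show "x \<otimes> y = \<^bold>0"
    using x y by (simp add: normal_simps)
qed (use x y in \<open>simp add: mult_assoc\<close>)

lemma dom_eq_zero_iff: "x \<in> carrier S \<Longrightarrow> x\<^sup>\<star> \<otimes> x = \<^bold>0 \<longleftrightarrow> x = \<^bold>0"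
  using sinv_cancel(1)[of x] by (metis mult_zero sinv_closed)

lemma sinv_eq_zero_iff [simp]: "x \<in> carrier S \<Longrightarrow> x\<^sup>\<star> = \<^bold>0 \<longleftrightarrow> x = \<^bold>0"
  by (metis idem_sinv sinv_sinv zero_idem)

lemma least_bottom_idem_order: "least idem_order \<^bold>0 (carrier idem_order)"
  by (auto simp: least_def idem_le_iff)

text \<open>
  The lattice operations of an order record are chosen elements, and the order records of \<open>S\<close> and
  of a corner differ outside the carrier of the corner. Relations between idempotents
  are common to both, so the Boolean structure is carried over in this form.
\<close>

lemma generalized_boolean_algebra_iff:
  "generalized_boolean_algebra idem_order \<longleftrightarrow>
    (\<forall>e\<in>E. \<forall>f\<in>E. \<exists>j. idem_join e f j) \<and>
    (\<forall>e\<in>E. \<forall>f\<in>E. \<forall>g\<in>E. \<forall>j. idem_join f g j \<longrightarrow> idem_join (e \<otimes> f) (e \<otimes> g) (e \<otimes> j)) \<and>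
    (\<forall>e\<in>E. \<forall>f\<in>E. f \<otimes> e = e \<longrightarrow> (\<exists>d\<in>E. e \<otimes> d = \<^bold>0 \<and> idem_join e d f))"
  (is "?L \<longleftrightarrow> ?join \<and> ?distrib \<and> ?compl")
proof -
  interpret partial_order idem_order
    by (rule partial_order_idem_order)
  have bottom: "\<bottom>\<^bsub>idem_order\<^esub> = \<^bold>0"
    unfolding bottom_def
    by (rule some_equality) (use least_bottom_idem_order least_unique in auto)
  have meet: "e \<sqinter>\<^bsub>idem_order\<^esub> f = e \<otimes> f" if "e \<in> E" "f \<in> E" for e f
    using that by (simp add: meet_def Lattice.inf_def greatest_Lower_idem_order_iff)
  have join: "e \<squnion>\<^bsub>idem_order\<^esub> f = j" if "idem_join e f j" "e \<in> E" "f \<in> E" for e f j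
  proof -
    have "least idem_order j (Upper idem_order {e, f})"
      using that by (simp add: least_Upper_idem_order_iff)
    with least_unique show ?thesis
      unfolding join_def Lattice.sup_def by (blast intro: some_equality)
  qed
  show ?thesis
  proof
    assume ?L
    then interpret L: generalized_boolean_algebra idem_order .
    have ex: "idem_join e f (e \<squnion>\<^bsub>idem_order\<^esub> f)" if "e \<in> E" "f \<in> E" for e f
      using L.sup_of_two_exists[of e f] join[of e f] that
      by (auto simp: least_Upper_idem_order_iff)
    have ?distrib
    proof safe
      fix e f g j
      assume e: "e \<in> E" and f: "f \<in> E" and g: "g \<in> E" and j: "idem_join f g j"
      have "j \<in> E"
        using j by (simp add: idem_join_def)
      have "e \<otimes> j = (e \<otimes> f) \<squnion>\<^bsub>idem_order\<^esub> (e \<otimes> g)"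
        using L.meet_join_distrib[of e f g] e f g \<open>j \<in> E\<close> join[OF j f g] by (simp add: meet)
      then show "idem_join (e \<otimes> f) (e \<otimes> g) (e \<otimes> j)"
        using ex e f g by simp
    qed
    moreover have ?compl
    proof safe
      fix e f
      assume e: "e \<in> E" and f: "f \<in> E" and "f \<otimes> e = e"
      then obtain d where "d \<in> E" "e \<otimes> d = \<^bold>0" "e \<squnion>\<^bsub>idem_order\<^esub> d = f"
        using L.sectionally_complemented[of e f] by (auto simp: idem_le_iff bottom meet)
      then show "\<exists>d\<in>E. e \<otimes> d = \<^bold>0 \<and> idem_join e d f"
        using ex[OF e] by blast
    qed
    ultimately show "?join \<and> ?distrib \<and> ?compl"
      using ex by blast
  next
    assume R: "?join \<and> ?distrib \<and> ?compl"
    have ex: "idem_join e f (e \<squnion>\<^bsub>idem_order\<^esub> f)" if "e \<in> E" "f \<in> E" for e f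
      using R join that by metis
    show ?L
    proof unfold_locales
      show "\<exists>s. least idem_order s (Upper idem_order {e, f})"
        if "e \<in> carrier idem_order" "f \<in> carrier idem_order" for e f
        using that ex by (auto simp: least_Upper_idem_order_iff)
      show "\<exists>s. greatest idem_order s (Lower idem_order {e, f})"
        if "e \<in> carrier idem_order" "f \<in> carrier idem_order" for e f
        using that by (auto simp: greatest_Lower_idem_order_iff)
      show "\<exists>x. least idem_order x (carrier idem_order)"
        using least_bottom_idem_order by blast
      show "e \<sqinter>\<^bsub>idem_order\<^esub> (f \<squnion>\<^bsub>idem_order\<^esub> g)
          = (e \<sqinter>\<^bsub>idem_order\<^esub> f) \<squnion>\<^bsub>idem_order\<^esub> (e \<sqinter>\<^bsub>idem_order\<^esub> g)"
        if "e \<in> carrier idem_order" "f \<in> carrier idem_order" "g \<in> carrier idem_order" for e f g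
      proof -
        have "idem_join (e \<otimes> f) (e \<otimes> g) (e \<otimes> (f \<squnion>\<^bsub>idem_order\<^esub> g))"
          using R ex that by simp
        moreover have "f \<squnion>\<^bsub>idem_order\<^esub> g \<in> E"
          using ex[of f g] that by (simp add: idem_join_def)
        ultimately show ?thesis
          using join that by (simp add: meet)
      qed
      show "\<exists>d\<in>carrier idem_order. e \<sqinter>\<^bsub>idem_order\<^esub> d = \<bottom>\<^bsub>idem_order\<^esub> \<and> e \<squnion>\<^bsub>idem_order\<^esub> d = f"
        if ef: "e \<in> carrier idem_order" "f \<in> carrier idem_order" "e \<sqsubseteq>\<^bsub>idem_order\<^esub> f" for e f
      proof -
        have "f \<otimes> e = e"
          using ef by (simp add: idem_le_iff)
        then obtain d where "d \<in> E" "e \<otimes> d = \<^bold>0" "idem_join e d f"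
          using R[THEN conjunct2, THEN conjunct2, rule_format, of e f] ef by auto
        then show ?thesis
          using join ef by (auto simp: bottom meet intro!: bexI[of _ d])
      qed
    qed
  qed
qed

end

section \<open>Corners of Boolean inverse semigroups\<close>

sublocale boolean_inverse_semigroup \<subseteq> inverse_semigroup_with_zero
  by unfold_locales (rule zero_exists)

context boolean_inverse_semigroup
begin

lemma orthogonal_join:
  assumes x: "x \<in> carrier S" and y: "y \<in> carrier S"
    and "x\<^sup>\<star> \<otimes> y = \<^bold>0" "x \<otimes> y\<^sup>\<star> = \<^bold>0"
  obtains s where "s \<in> carrier S" "x \<preceq> s" "y \<preceq> s"
    "\<And>u. \<lbrakk>u \<in> carrier S; x \<preceq> u; y \<preceq> u\<rbrakk> \<Longrightarrow> s \<preceq> u"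
proof -
  have "orthogonal S x y"
    using assms by (simp add: orthogonal_def)
  then obtain s where "least (natural_order S) s (Upper (natural_order S) {x, y})"
    using orthogonal_join_exists x y by blast
  then show thesis
    using x y by (intro that[of s]) (auto simp: least_def Upper_def)
qed

end

definition corner :: "('a, 'm) monoid_scheme \<Rightarrow> 'a \<Rightarrow> 'a monoid" where
  "corner S e =
    \<lparr>carrier = {x \<in> carrier S. e \<otimes>\<^bsub>S\<^esub> x = x \<and> x \<otimes>\<^bsub>S\<^esub> e = x},
     monoid.mult = (\<otimes>\<^bsub>S\<^esub>),
     one = e\<rparr>"

lemma corner_sel [simp]:
  "x \<in> carrier (corner S e) \<longleftrightarrow> x \<in> carrier S \<and> e \<otimes>\<^bsub>S\<^esub> x = x \<and> x \<otimes>\<^bsub>S\<^esub> e = x"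
  "x \<otimes>\<^bsub>corner S e\<^esub> y = x \<otimes>\<^bsub>S\<^esub> y"
  "\<one>\<^bsub>corner S e\<^esub> = e"
  by (simp_all add: corner_def)

context inverse_semigroup
begin

lemma corner_sinv_closed:
  assumes e: "e \<in> E" and x: "x \<in> carrier (corner S e)"
  shows "x\<^sup>\<star> \<in> carrier (corner S e)"
proof -
  have "x\<^sup>\<star> \<otimes> e = x\<^sup>\<star>" "e \<otimes> x\<^sup>\<star> = x\<^sup>\<star>"
    using sinv_mult[of e x] sinv_mult[of x e] e x by auto
  then show ?thesis
    using x by simp
qed

lemma inverse_semigroup_corner:
  assumes e: "e \<in> E"
  shows "inverse_semigroup (corner S e)"
proof
  fix x y assume x: "x \<in> carrier (corner S e)"
  show "\<exists>!y. y \<in> carrier (corner S e) \<and> x = x \<otimes>\<^bsub>corner S e\<^esub> y \<otimes>\<^bsub>corner S e\<^esub> x \<and>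
      y = y \<otimes>\<^bsub>corner S e\<^esub> x \<otimes>\<^bsub>corner S e\<^esub> y"
  proof (rule ex1I[of _ "x\<^sup>\<star>"])
    show "x\<^sup>\<star> \<in> carrier (corner S e) \<and> x = x \<otimes>\<^bsub>corner S e\<^esub> x\<^sup>\<star> \<otimes>\<^bsub>corner S e\<^esub> x \<and>
      x\<^sup>\<star> = x\<^sup>\<star> \<otimes>\<^bsub>corner S e\<^esub> x \<otimes>\<^bsub>corner S e\<^esub> x\<^sup>\<star>"
      using corner_sinv_closed[OF e x] x by (simp add: sinv_props)
  qed (use x sinv_unique in auto)
  assume y: "y \<in> carrier (corner S e)"
  show "x \<otimes>\<^bsub>corner S e\<^esub> y \<in> carrier (corner S e)"
    using x y e mult_assoc[of e x y] mult_assoc[of x y e] by simp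
qed (use e in \<open>auto simp: mult_assoc\<close>)

lemma
  assumes e: "e \<in> E"
  shows idempotents_corner: "idempotents (corner S e) = {f \<in> E. e \<otimes> f = f}"
    and corner_sinv: "x \<in> carrier (corner S e) \<Longrightarrow> semigroup_inv (corner S e) x = x\<^sup>\<star>"
proof -
  interpret C: inverse_semigroup "corner S e"
    using e by (rule inverse_semigroup_corner)
  show "idempotents (corner S e) = {f \<in> E. e \<otimes> f = f}"
  proof (rule Set.set_eqI)
    fix f
    have "f \<in> idempotents (corner S e) \<longleftrightarrow> f \<in> E \<and> e \<otimes> f = f \<and> f \<otimes> e = f"
      unfolding idempotents_def by auto
    then show "f \<in> idempotents (corner S e) \<longleftrightarrow> f \<in> {f \<in> E. e \<otimes> f = f}"
      using idem_commute[OF e, of f] by auto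
  qed
  show "semigroup_inv (corner S e) x = x\<^sup>\<star>" if "x \<in> carrier (corner S e)"
    using that e corner_sinv_closed[OF e that] by (intro C.sinv_unique) (auto simp: sinv_props)
qed

lemma corner_le_iff:
  assumes "e \<in> E" "x \<in> carrier (corner S e)"
  shows "x \<sqsubseteq>\<^bsub>natural_order (corner S e)\<^esub> y \<longleftrightarrow> x \<preceq> y"
  using corner_sinv[OF assms] by (simp add: natural_order_def)

text \<open>
  For a least upper bound \<open>s\<close> of elements \<open>x\<close> with \<open>x \<otimes> e = x\<close>, the direction from right to left
  makes \<open>s \<otimes> e\<close> an upper bound, and the other direction then gives \<open>s \<otimes> e = s\<close>. In this way joins
  stay within a corner and away from idempotents that annihilate the summands.
\<close>

lemma le_mult_idem_iff:
  assumes x: "x \<in> carrier S" and y: "y \<in> carrier S" and e: "e \<in> E"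
  shows "x \<preceq> y \<otimes> e \<longleftrightarrow> x \<preceq> y \<and> x \<otimes> e = x"
proof -
  define d where "d = x\<^sup>\<star> \<otimes> x"
  have d [simp]: "d \<in> E" and xd: "x \<otimes> d = x"
    using x by (auto simp: d_def normal_simps)
  show ?thesis
  proof
    assume "x \<preceq> y \<otimes> e"
    then have *: "y \<otimes> (e \<otimes> d) = x"
      using x y e by (simp add: le_iff d_def mult_assoc)
    have "(e \<otimes> d) \<otimes> e = e \<otimes> d"
      using e idem_commute[OF e d] by (simp add: mult_assoc)
    then have "y \<otimes> (e \<otimes> d) \<otimes> e = y \<otimes> (e \<otimes> d)"
      using y e mult_assoc[of y "e \<otimes> d" e] by simp
    moreover have "y \<otimes> (e \<otimes> d) \<preceq> y"
      using y e by (intro mult_idem_le) simp_all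
    ultimately show "x \<preceq> y \<and> x \<otimes> e = x"
      by (simp add: *)
  next
    assume *: "x \<preceq> y \<and> x \<otimes> e = x"
    then have "d \<otimes> e = d"
      using x e by (simp add: d_def mult_assoc)
    with * show "x \<preceq> y \<otimes> e"
      using x y e idem_commute[OF e d] by (simp add: le_iff mult_assoc flip: d_def)
  qed
qed

lemma le_idem_mult_iff:
  assumes x: "x \<in> carrier S" and y: "y \<in> carrier S" and e: "e \<in> E"
  shows "x \<preceq> e \<otimes> y \<longleftrightarrow> x \<preceq> y \<and> e \<otimes> x = x"
proof -
  have le: "u \<preceq> v \<longleftrightarrow> u\<^sup>\<star> \<preceq> v\<^sup>\<star>" if "u \<in> carrier S" "v \<in> carrier S" for u v
    using that le_sinv[of u v] le_sinv[of "u\<^sup>\<star>" "v\<^sup>\<star>"] by auto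
  have "x\<^sup>\<star> \<otimes> e = x\<^sup>\<star> \<longleftrightarrow> (x\<^sup>\<star> \<otimes> e)\<^sup>\<star> = x\<^sup>\<star>\<^sup>\<star>"
    using x e sinv_sinv by (metis idem_closed mult_closed sinv_closed)
  also have "\<dots> \<longleftrightarrow> e \<otimes> x = x"
    using x e by (simp add: sinv_mult)
  finally show ?thesis
    using le_mult_idem_iff[of "x\<^sup>\<star>" "y\<^sup>\<star>" e] le[of x "e \<otimes> y"] le[of x y] x y e
    by (simp add: sinv_mult)
qed

text \<open>
  An upper bound \<open>h\<close> taken anywhere in \<open>S\<close> can be replaced by \<open>e \<otimes> h\<close>, which lies in the corner.
\<close>

lemma idem_join_corner_iff:
  assumes e: "e \<in> E" and f: "f \<in> E" "e \<otimes> f = f" and g: "g \<in> E" "e \<otimes> g = g"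
  shows "inverse_semigroup.idem_join (corner S e) f g j \<longleftrightarrow> idem_join f g j"
proof -
  interpret C: inverse_semigroup "corner S e"
    using e by (rule inverse_semigroup_corner)
  have CE: "h \<in> C.E \<longleftrightarrow> h \<in> E \<and> e \<otimes> h = h" for h
    using e by (simp add: idempotents_corner)
  show ?thesis
  proof
    assume C: "C.idem_join f g j"
    then have j: "j \<in> E" "e \<otimes> j = j" "j \<otimes> f = f" "j \<otimes> g = g"
      by (auto simp: C.idem_join_def CE)
    have "h \<otimes> j = j" if h: "h \<in> E" "h \<otimes> f = f" "h \<otimes> g = g" for h
    proof -
      have "e \<otimes> h \<in> C.E"
        using e h by (simp add: CE idem_cancel_left)
      moreover have "(e \<otimes> h) \<otimes> f = f" "(e \<otimes> h) \<otimes> g = g"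
        using e f g h by (simp_all add: mult_assoc)
      ultimately have "(e \<otimes> h) \<otimes> j = j"
        using C by (simp add: C.idem_join_def)
      then show ?thesis
        using j e h by (simp add: idem_commute[of e h] mult_assoc)
    qed
    then show "idem_join f g j"
      using j by (simp add: idem_join_def)
  next
    assume j: "idem_join f g j"
    then show "C.idem_join f g j"
      using e f g by (simp add: C.idem_join_def idem_join_def CE)
  qed
qed

end

context boolean_inverse_semigroup
begin

text \<open>
  Inverses, differences of idempotents and orthogonal joins of elements of the corner are formed in \<open>S\<close>
  and turn out to lie in the corner again.
\<close>

theorem boolean_inverse_monoid_corner:
  assumes e: "e \<in> E"
  shows "boolean_inverse_monoid (corner S e)"
proof -
  let ?C = "corner S e"
  have is_zero: "is_zero ?C \<^bold>0"
    using e by (simp add: is_zero_def)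
  interpret C: inverse_semigroup ?C
    using e by (rule inverse_semigroup_corner)
  interpret C: inverse_semigroup_with_zero ?C
    by unfold_locales (use is_zero in blast)
  have zero: "semigroup_zero ?C = \<^bold>0"
    using is_zero by (rule C.semigroup_zeroI)
  note idem = idempotents_corner[OF e]
  have gba: "(\<exists>j. idem_join f g j)"
    "f \<otimes> g = g \<Longrightarrow> \<exists>d\<in>E. g \<otimes> d = \<^bold>0 \<and> idem_join g d f" if "f \<in> E" "g \<in> E" for f g
    using idempotents_generalized_boolean_algebra that
    unfolding generalized_boolean_algebra_iff by auto
  have distrib: "idem_join (f \<otimes> g) (f \<otimes> h) (f \<otimes> j)"
    if "f \<in> E" "g \<in> E" "h \<in> E" "idem_join g h j" for f g h j
    using idempotents_generalized_boolean_algebra that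
    unfolding generalized_boolean_algebra_iff by auto
  show ?thesis
  proof (intro boolean_inverse_monoid.intro boolean_inverse_semigroup.intro
      boolean_inverse_semigroup_axioms.intro)
    show "inverse_semigroup ?C" "\<exists>z. is_zero ?C z"
      using C.inverse_semigroup_axioms is_zero by auto
    show "monoid ?C"
      by (rule monoidI) (use e C.mult_closed C.mult_assoc in auto)
    show "generalized_boolean_algebra C.idem_order"
      unfolding C.generalized_boolean_algebra_iff
    proof (intro conjI ballI allI impI)
      show "\<exists>j. C.idem_join f g j" if "f \<in> C.E" "g \<in> C.E" for f g
        using gba(1)[of f g] that idem_join_corner_iff[OF e] by (auto simp: idem)
      show "C.idem_join (f \<otimes>\<^bsub>?C\<^esub> g) (f \<otimes>\<^bsub>?C\<^esub> h) (f \<otimes>\<^bsub>?C\<^esub> j)"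
        if "f \<in> C.E" "g \<in> C.E" "h \<in> C.E" "C.idem_join g h j" for f g h j
        using that distrib[of f g h j] e
        by (simp add: idem idem_join_corner_iff idem_mult_closed flip: mult_assoc)
      show "\<exists>d\<in>C.E. g \<otimes>\<^bsub>?C\<^esub> d = semigroup_zero ?C \<and> C.idem_join g d f"
        if fg: "g \<in> C.E" "f \<in> C.E" "f \<otimes>\<^bsub>?C\<^esub> g = g" for f g
      proof -
        obtain d where d: "d \<in> E" "g \<otimes> d = \<^bold>0" "idem_join g d f"
          using gba(2)[of f g] fg by (auto simp: idem)
        then have "f \<otimes> d = d" "f \<in> E"
          using idem_join_def by auto
        then have "e \<otimes> d = d"
          using fg d e by (simp add: idem) (metis idem_closed mult_assoc)
        then show ?thesis
          using d fg idem_join_corner_iff[OF e] by (auto simp: idem zero intro!: bexI[of _ d])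
      qed
    qed
    show "\<exists>s. least (natural_order ?C) s (Upper (natural_order ?C) {x, y})"
      if x: "x \<in> carrier ?C" and y: "y \<in> carrier ?C" and xy: "orthogonal ?C x y" for x y
    proof -
      have "x\<^sup>\<star> \<otimes> y = \<^bold>0" "x \<otimes> y\<^sup>\<star> = \<^bold>0"
        using xy x y e by (auto simp: orthogonal_def corner_sinv zero)
      then obtain s where s: "s \<in> carrier S" "x \<preceq> s" "y \<preceq> s"
          "\<And>u. \<lbrakk>u \<in> carrier S; x \<preceq> u; y \<preceq> u\<rbrakk> \<Longrightarrow> s \<preceq> u"
        using x y orthogonal_join by (metis corner_sel(1))
      have "x \<preceq> s \<otimes> e" "y \<preceq> s \<otimes> e" "x \<preceq> e \<otimes> s" "y \<preceq> e \<otimes> s"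
        using s x y e by (simp_all add: le_mult_idem_iff le_idem_mult_iff)
      then have "s \<preceq> s \<otimes> e" "s \<preceq> e \<otimes> s"
        using s e by simp_all
      then have "s \<in> carrier ?C"
        using s e by (simp add: le_mult_idem_iff le_idem_mult_iff)
      then show ?thesis
        using s x y e corner_le_iff by (auto simp: least_def Upper_def intro!: exI[of _ s])
    qed
  qed
qed

end

section \<open>Atoms\<close>

context boolean_inverse_monoid
begin

lemma one_idem [simp]: "\<one> \<in> E"
  by (rule idemI) simp_all

text \<open>
  With \<open>d\<close> the complement of \<open>e\<close> in \<open>\<one>\<close>, distributivity splits the domain idempotent of \<open>x\<close> into its
  parts below \<open>e\<close> and below \<open>d\<close>, and one of them is zero.
\<close>

lemma idem_complement:
  assumes e: "e \<in> E"
  obtains d where "d \<in> E" "e \<otimes> d = \<^bold>0"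
    "\<And>x. \<lbrakk>x \<in> carrier S; x \<otimes> e = \<^bold>0\<rbrakk> \<Longrightarrow> x \<otimes> d = x"
    "\<And>x. \<lbrakk>x \<in> carrier S; x \<otimes> d = \<^bold>0\<rbrakk> \<Longrightarrow> x \<otimes> e = x"
proof -
  note gba = idempotents_generalized_boolean_algebra[unfolded generalized_boolean_algebra_iff]
  have "\<exists>d\<in>E. e \<otimes> d = \<^bold>0 \<and> idem_join e d \<one>"
    using gba e by simp
  then obtain d where d: "d \<in> E" "e \<otimes> d = \<^bold>0" and j: "idem_join e d \<one>"
    by blast
  have "x \<otimes> h = x"
    if x: "x \<in> carrier S" "x \<otimes> g = \<^bold>0" and gh: "g \<in> E" "h \<in> E" "idem_join g h \<one>" for x g h
  proof -
    define f where "f = x\<^sup>\<star> \<otimes> x"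
    have f: "f \<in> E" "x \<otimes> f = x" and fg: "f \<otimes> g = \<^bold>0"
      using x gh by (simp_all add: f_def normal_simps)
    have "idem_join (f \<otimes> g) (f \<otimes> h) (f \<otimes> \<one>)"
      using gba gh f by (metis one_idem)
    then have "idem_join \<^bold>0 (f \<otimes> h) f"
      using f fg by simp
    moreover have "(f \<otimes> h) \<otimes> (f \<otimes> h) = f \<otimes> h"
      using f gh by (intro idem_idem) simp
    ultimately have "(f \<otimes> h) \<otimes> f = f"
      using f gh by (auto simp: idem_join_def)
    then have "f \<otimes> h = f"
      using f gh idem_commute[of h f] by (simp add: normal_simps)
    then show ?thesis
      using x f gh mult_assoc[of x f h] by simp
  qed
  moreover have "idem_join d e \<one>"
    using j by (auto simp: idem_join_def)
  ultimately show thesis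
    using d e j that by blast
qed

text \<open>
  A weak form of distributivity over joins: if \<open>d\<close> is the complement of \<open>e\<close> then \<open>s \<otimes> d\<close> is still an upper
  bound of \<open>x\<close> and \<open>y\<close>, so that \<open>s = s \<otimes> d\<close>.
\<close>

lemma lub_mult_eq_zero:
  assumes c: "x \<in> carrier S" "y \<in> carrier S" "s \<in> carrier S" and e: "e \<in> E"
    and le: "x \<preceq> s" "y \<preceq> s"
    and least: "\<And>u. \<lbrakk>u \<in> carrier S; x \<preceq> u; y \<preceq> u\<rbrakk> \<Longrightarrow> s \<preceq> u"
    and zero: "x \<otimes> e = \<^bold>0" "y \<otimes> e = \<^bold>0"
  shows "s \<otimes> e = \<^bold>0"
proof -
  obtain d where d: "d \<in> E" "e \<otimes> d = \<^bold>0"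
    and compl: "\<And>x. \<lbrakk>x \<in> carrier S; x \<otimes> e = \<^bold>0\<rbrakk> \<Longrightarrow> x \<otimes> d = x"
    by (rule idem_complement[OF e]) blast
  have "s \<preceq> s \<otimes> d"
    using c d le zero compl by (intro least) (simp_all add: le_mult_idem_iff)
  then have "s \<otimes> d = s"
    using c d by (simp add: le_mult_idem_iff)
  moreover have "s \<otimes> d \<otimes> e = \<^bold>0"
    using c d e idem_commute[of d e] by (simp add: mult_assoc)
  ultimately show ?thesis
    by simp
qed

definition atoms :: "'a set" where
  "atoms = {a \<in> E. a \<noteq> \<^bold>0 \<and> (\<forall>f\<in>E. a \<otimes> f = \<^bold>0 \<or> a \<otimes> f = a)}"

lemma atomI: "\<lbrakk>a \<in> E; a \<noteq> \<^bold>0; \<And>f. f \<in> E \<Longrightarrow> a \<otimes> f = \<^bold>0 \<or> a \<otimes> f = a\<rbrakk> \<Longrightarrow> a \<in> atoms"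
  and atom_idem [simp]: "a \<in> atoms \<Longrightarrow> a \<in> E"
  and atom_nonzero: "a \<in> atoms \<Longrightarrow> a \<noteq> \<^bold>0"
  and atom_cases: "\<lbrakk>a \<in> atoms; f \<in> E\<rbrakk> \<Longrightarrow> a \<otimes> f = \<^bold>0 \<or> a \<otimes> f = a"
  by (auto simp: atoms_def)

lemma atoms_orthogonal:
  assumes "a \<in> atoms" "b \<in> atoms" "a \<noteq> b"
  shows "a \<otimes> b = \<^bold>0"
  using assms atom_cases[of a b] atom_cases[of b a] idem_commute[of a b] by auto

text \<open>
  The domain idempotent of \<open>x \<otimes> a\<close> lies below the atom \<open>a\<close>.
\<close>

lemma atom_dom_cases:
  assumes x: "x \<in> carrier S" and a: "a \<in> atoms"
  shows "x \<otimes> a = \<^bold>0 \<or> (x \<otimes> a)\<^sup>\<star> \<otimes> (x \<otimes> a) = a"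
proof -
  have "a \<otimes> (d \<otimes> a) = a \<otimes> d" if "d \<in> E" for d
    using that a idem_commute[of d a] by (simp add: normal_simps)
  from this[of "x\<^sup>\<star> \<otimes> x"] have "(x \<otimes> a)\<^sup>\<star> \<otimes> (x \<otimes> a) = a \<otimes> (x\<^sup>\<star> \<otimes> x)"
    using x a by (simp add: sinv_mult mult_assoc)
  then show ?thesis
    using atom_cases[OF a, of "x\<^sup>\<star> \<otimes> x"] x a dom_eq_zero_iff[of "x \<otimes> a"] by auto
qed

text \<open>
  Restricted to an atom, an element can only grow from zero: \<open>x \<otimes> a\<close> already has the full domain \<open>a\<close>.
\<close>

lemma le_mult_atom:
  assumes "x \<in> carrier S" "y \<in> carrier S" "x \<preceq> y" "a \<in> atoms" "x \<otimes> a \<noteq> \<^bold>0"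
  shows "y \<otimes> a = x \<otimes> a"
proof -
  have "x \<otimes> a \<preceq> y"
    using assms mult_idem_le[of x a] le_trans[of "x \<otimes> a" x y] by simp
  then have "y \<otimes> ((x \<otimes> a)\<^sup>\<star> \<otimes> (x \<otimes> a)) = x \<otimes> a"
    using assms by (simp add: le_iff)
  then show ?thesis
    using assms atom_dom_cases[of x a] by simp
qed

text \<open>
  With \<open>y = x \<otimes> a\<close>, conjugation by \<open>y\<close> is an order isomorphism from the idempotents below \<open>a\<close> to
  those below the range \<open>y \<otimes> y\<^sup>\<star>\<close>, so that the range is an atom too.
\<close>

lemma atom_ran:
  assumes x: "x \<in> carrier S" and a: "a \<in> atoms" and nz: "x \<otimes> a \<noteq> \<^bold>0"
  shows "(x \<otimes> a) \<otimes> (x \<otimes> a)\<^sup>\<star> \<in> atoms"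
proof -
  define y where "y = x \<otimes> a"
  have y [simp]: "y \<in> carrier S" and nz: "y \<noteq> \<^bold>0" and dom: "y\<^sup>\<star> \<otimes> y = a"
    using x a nz atom_dom_cases[OF x a] by (simp_all add: y_def)
  have "(y \<otimes> y\<^sup>\<star>) \<otimes> f = \<^bold>0 \<or> (y \<otimes> y\<^sup>\<star>) \<otimes> f = y \<otimes> y\<^sup>\<star>" if f: "f \<in> E" for f
  proof -
    have c: "y\<^sup>\<star> \<otimes> (f \<otimes> y) \<in> E"
      using conj_idem[of "y\<^sup>\<star>" f] f by simp
    have "(y \<otimes> y\<^sup>\<star>) \<otimes> f = (y \<otimes> y\<^sup>\<star>) \<otimes> f \<otimes> (y \<otimes> y\<^sup>\<star>)"
      using f idem_commute[of "y \<otimes> y\<^sup>\<star>" f] by (simp add: normal_simps)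
    also have "\<dots> = y \<otimes> (a \<otimes> (y\<^sup>\<star> \<otimes> (f \<otimes> y))) \<otimes> y\<^sup>\<star>"
      using f by (simp add: normal_simps flip: dom)
    finally have eq: "(y \<otimes> y\<^sup>\<star>) \<otimes> f = y \<otimes> (a \<otimes> (y\<^sup>\<star> \<otimes> (f \<otimes> y))) \<otimes> y\<^sup>\<star>" .
    have "y \<otimes> a = y"
      by (simp add: normal_simps flip: dom)
    from atom_cases[OF a c] show ?thesis
    proof
      assume "a \<otimes> (y\<^sup>\<star> \<otimes> (f \<otimes> y)) = \<^bold>0"
      with eq show ?thesis
        by simp
    next
      assume "a \<otimes> (y\<^sup>\<star> \<otimes> (f \<otimes> y)) = a"
      with eq \<open>y \<otimes> a = y\<close> show ?thesis
        by simp
    qed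
  qed
  moreover have "y \<otimes> y\<^sup>\<star> \<noteq> \<^bold>0"
    using dom_eq_zero_iff[of "y\<^sup>\<star>"] nz by simp
  ultimately show ?thesis
    unfolding y_def[symmetric] by (intro atomI) simp_all
qed

lemma atom_image:
  assumes x: "x \<in> carrier S" and a: "a \<in> atoms" and nz: "x \<otimes> a \<noteq> \<^bold>0"
  obtains b where "b \<in> atoms" "b \<otimes> (x \<otimes> a) = x \<otimes> a" "(x \<otimes> a) \<otimes> (x \<otimes> a)\<^sup>\<star> = b"
  by (rule that[OF atom_ran[OF assms]]) (use x a mult_sinv_mult[of "x \<otimes> a"] in simp_all)

text \<open>
  Distinct atoms are orthogonal, so only the range idempotent of \<open>x \<otimes> a\<close> fails to annihilate it.
  For matrices this will say that a column has at most one nonzero entry.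
\<close>

lemma atom_image_unique:
  assumes x: "x \<in> carrier S" and "a \<in> atoms" "b \<in> atoms" "c \<in> atoms"
    and "b \<otimes> (x \<otimes> a) \<noteq> \<^bold>0" "c \<otimes> (x \<otimes> a) \<noteq> \<^bold>0"
  shows "b = c"
proof -
  have "x \<otimes> a \<noteq> \<^bold>0"
    using assms by auto
  then obtain d where d: "d \<in> atoms" "d \<otimes> (x \<otimes> a) = x \<otimes> a"
    using atom_image assms by metis
  have "b' = d" if "b' \<in> atoms" "b' \<otimes> (x \<otimes> a) \<noteq> \<^bold>0" for b'
  proof (rule ccontr)
    assume "b' \<noteq> d"
    then have "(b' \<otimes> d) \<otimes> (x \<otimes> a) = \<^bold>0"
      using atoms_orthogonal that d x \<open>a \<in> atoms\<close> by simp
    then show False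
      using that d x \<open>a \<in> atoms\<close> by (simp add: mult_assoc)
  qed
  then show ?thesis
    using assms by blast
qed

end

locale finite_boolean_inverse_monoid = boolean_inverse_monoid +
  assumes finite_idem: "finite E"
begin

lemma finite_atoms [simp]: "finite atoms"
  using finite_idem by (rule rev_finite_subset) auto

text \<open>
  An idempotent that is not an atom lies strictly above a nonzero one, below which there are
  fewer idempotents.
\<close>

lemma atom_below:
  assumes "f \<in> E" "f \<noteq> \<^bold>0"
  obtains a where "a \<in> atoms" "f \<otimes> a = a"
proof -
  define below where "below f = {g \<in> E. f \<otimes> g = g}" for f
  have fin: "finite (below f)" for f
    using finite_idem by (simp add: below_def)
  have "\<exists>a\<in>atoms. f \<otimes> a = a"
    using assms
  proof (induction "card (below f)" arbitrary: f rule: less_induct)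
    case less
    show ?case
    proof (cases "f \<in> atoms")
      case True
      then show ?thesis
        using less.prems by (intro bexI[of _ f]) simp_all
    next
      case False
      then obtain g where g: "g \<in> E" "f \<otimes> g \<noteq> \<^bold>0" "f \<otimes> g \<noteq> f"
        using less.prems atomI by blast
      have f: "f \<in> E" and fg: "f \<otimes> g \<in> E" "f \<otimes> (f \<otimes> g) = f \<otimes> g"
        using less.prems g by (simp_all add: idem_cancel_left)
      have "f \<notin> below (f \<otimes> g)"
        using f fg g idem_commute[of "f \<otimes> g" f] by (simp add: below_def)
      moreover have "f \<in> below f"
        using f by (simp add: below_def)
      moreover have "below (f \<otimes> g) \<subseteq> below f"
      proof
        fix h assume "h \<in> below (f \<otimes> g)"
        then show "h \<in> below f"
          using absorb_trans[of f "f \<otimes> g" h] f fg by (simp add: below_def)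
      qed
      ultimately have "below (f \<otimes> g) \<subset> below f"
        by blast
      then have "card (below (f \<otimes> g)) < card (below f)"
        using fin by (rule psubset_card_mono[rotated])
      then obtain a where "a \<in> atoms" "f \<otimes> g \<otimes> a = a"
        using less.hyps[of "f \<otimes> g"] fg g by auto
      then have "f \<otimes> a = a"
        using f fg absorb_trans[of f "f \<otimes> g" a] by simp
      then show ?thesis
        using \<open>a \<in> atoms\<close> by blast
    qed
  qed
  then show thesis
    using that by blast
qed

lemma eq_zero_if_atoms:
  assumes x: "x \<in> carrier S" and zero: "\<And>a. a \<in> atoms \<Longrightarrow> x \<otimes> a = \<^bold>0"
  shows "x = \<^bold>0"
proof (rule ccontr)
  assume "x \<noteq> \<^bold>0"
  then obtain a where a: "a \<in> atoms" "(x\<^sup>\<star> \<otimes> x) \<otimes> a = a"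
    using atom_below[of "x\<^sup>\<star> \<otimes> x"] x dom_eq_zero_iff by auto
  then show False
    using zero[of a] atom_nonzero[of a] x mult_sinv_eq_zero_iff[of x a] by simp
qed

text \<open>
  The join \<open>s\<close> of a set of atoms is taken one orthogonal step at a time, so that it is a supremum
  in all of \<open>S\<close> and not only among the idempotents. The upper bound \<open>u\<close> to which it is applied
  below is a product \<open>x\<^sup>\<star> \<otimes> y\<close>, which is not known to be idempotent.
\<close>

lemma atoms_lub:
  assumes "A \<subseteq> atoms"
  obtains s where "s \<in> E" "\<And>a. a \<in> A \<Longrightarrow> s \<otimes> a = a"
    "\<And>u. \<lbrakk>u \<in> carrier S; \<And>a. a \<in> A \<Longrightarrow> u \<otimes> a = a\<rbrakk> \<Longrightarrow> u \<otimes> s = s"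
proof -
  have "finite A"
    using assms finite_atoms finite_subset by blast
  then have "\<exists>s\<in>E. (\<forall>a\<in>A. s \<otimes> a = a) \<and>
      (\<forall>u\<in>carrier S. (\<forall>a\<in>A. u \<otimes> a = a) \<longrightarrow> u \<otimes> s = s)"
    using assms
  proof (induction A)
    case empty
    then show ?case
      by (intro bexI[of _ "\<^bold>0"]) auto
  next
    case (insert a A)
    then obtain s where s: "s \<in> E" "\<And>b. b \<in> A \<Longrightarrow> s \<otimes> b = b"
      and s_least: "\<And>u. \<lbrakk>u \<in> carrier S; \<And>b. b \<in> A \<Longrightarrow> u \<otimes> b = b\<rbrakk> \<Longrightarrow> u \<otimes> s = s"
      by auto
    have a: "a \<in> atoms"
      using insert by simp
    show ?case
    proof (cases "a \<otimes> s = \<^bold>0")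
      case False
      then have "s \<otimes> a = a"
        using atom_cases[OF a s(1)] idem_commute[of a s] a s by auto
      then show ?thesis
        using s s_least by (intro bexI[of _ s]) auto
    next
      case True
      then obtain t where t: "t \<in> carrier S" "s \<preceq> t" "a \<preceq> t"
        and t_least: "\<And>u. \<lbrakk>u \<in> carrier S; s \<preceq> u; a \<preceq> u\<rbrakk> \<Longrightarrow> t \<preceq> u"
        using orthogonal_join[of s a] a s idem_commute[of a s] by (metis atom_idem idem_closed idem_sinv)
      have "t \<preceq> \<one>"
        using a s by (intro t_least) (simp_all add: idem_le_iff)
      then have "t = t\<^sup>\<star> \<otimes> t"
        using t by (simp add: le_iff)
      then have tE: "t \<in> E"
        using t dom_idem by metis
      have st: "t \<otimes> s = s" "t \<otimes> a = a"
        using t s a by (simp_all add: idem_le_iff)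
      have "t \<otimes> b = b" if "b \<in> insert a A" for b
      proof -
        have "t \<otimes> (s \<otimes> b) = s \<otimes> b" if "b \<in> E" for b
          using that st t s mult_assoc[of t s b] by simp
        then show ?thesis
          using that st s insert.prems by (metis atom_idem insertE insert_subset subset_iff)
      qed
      moreover have "u \<otimes> t = t" if "u \<in> carrier S" "\<forall>b\<in>insert a A. u \<otimes> b = b" for u
        using t_least[of u] s_least[of u] that tE s a by (simp add: idem_le_iff)
      ultimately show ?thesis
        using tE by blast
    qed
  qed
  then show thesis
    using that by blast
qed

text \<open>
  There is no atom below the difference of \<open>e\<close> and the join of the atoms below \<open>e\<close>, so \<open>e\<close> is that join.
\<close>

lemma idem_le_if_atoms:
  assumes e: "e \<in> E" and u: "u \<in> carrier S"
    and atoms: "\<And>a. \<lbrakk>a \<in> atoms; e \<otimes> a = a\<rbrakk> \<Longrightarrow> u \<otimes> a = a"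
  shows "u \<otimes> e = e"
proof -
  obtain s where s: "s \<in> E" and s_atom: "\<And>a. a \<in> {a \<in> atoms. e \<otimes> a = a} \<Longrightarrow> s \<otimes> a = a"
    and least: "\<And>u. \<lbrakk>u \<in> carrier S; \<And>a. a \<in> {a \<in> atoms. e \<otimes> a = a} \<Longrightarrow> u \<otimes> a = a\<rbrakk>
      \<Longrightarrow> u \<otimes> s = s"
    using atoms_lub[of "{a \<in> atoms. e \<otimes> a = a}"] by blast
  obtain d where d: "d \<in> E" "s \<otimes> d = \<^bold>0"
    and compl: "\<And>x. \<lbrakk>x \<in> carrier S; x \<otimes> d = \<^bold>0\<rbrakk> \<Longrightarrow> x \<otimes> s = x"
    by (rule idem_complement[OF s]) blast
  have "e \<otimes> d = \<^bold>0"
  proof (rule ccontr)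
    assume "e \<otimes> d \<noteq> \<^bold>0"
    then obtain a where a: "a \<in> atoms" "e \<otimes> d \<otimes> a = a"
      using atom_below[of "e \<otimes> d"] e d by auto
    have "e \<otimes> a = a"
      using absorb_trans[of e "e \<otimes> d" a] a e d by (simp add: idem_cancel_left)
    moreover have "d \<otimes> a = a"
      using absorb_trans[of d "e \<otimes> d" a] a e d idem_left_commute[of d e d] by simp
    ultimately have "s \<otimes> (d \<otimes> a) = a"
      using a s_atom by simp
    then have "a = \<^bold>0"
      using a s d mult_assoc[of s d a] by simp
    then show False
      using a atom_nonzero by blast
  qed
  then have "e \<otimes> s = e"
    using compl e by simp
  moreover have "u \<otimes> s = s"
    using least u atoms by blast
  ultimately show ?thesis
    using absorb_trans[of u s e] u e s idem_commute[of e s] by simp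
qed

text \<open>
  If \<open>a\<close> is an atom below the domain \<open>d\<close> of \<open>x\<close> then \<open>x\<^sup>\<star> \<otimes> y \<otimes> a = x\<^sup>\<star> \<otimes> x \<otimes> a = a\<close>. So \<open>d\<close>
  lies below \<open>x\<^sup>\<star> \<otimes> y\<close>, which gives \<open>x \<preceq> y\<close>; now exchange \<open>x\<close> and \<open>y\<close>.
\<close>

lemma eq_if_atoms:
  assumes x: "x \<in> carrier S" and y: "y \<in> carrier S"
    and eq: "\<And>a. a \<in> atoms \<Longrightarrow> x \<otimes> a = y \<otimes> a"
  shows "x = y"
proof -
  have "x \<preceq> y" if x: "x \<in> carrier S" and y: "y \<in> carrier S"
    and eq: "\<And>a. a \<in> atoms \<Longrightarrow> x \<otimes> a = y \<otimes> a" for x y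
  proof -
    define d where "d = x\<^sup>\<star> \<otimes> x"
    have d: "d \<in> E"
      using x by (simp add: d_def)
    have "(x\<^sup>\<star> \<otimes> y) \<otimes> d = d"
    proof (rule idem_le_if_atoms)
      fix a assume a: "a \<in> atoms" "d \<otimes> a = a"
      then have "x\<^sup>\<star> \<otimes> y \<otimes> a = d \<otimes> a"
        using x y eq[of a] by (simp add: d_def mult_assoc)
      then show "x\<^sup>\<star> \<otimes> y \<otimes> a = a"
        using a by simp
    qed (use x y d in auto)
    then have "x \<otimes> ((x\<^sup>\<star> \<otimes> y) \<otimes> d) = x"
      using x by (simp add: d_def normal_simps)
    then have "(x \<otimes> x\<^sup>\<star>) \<otimes> (y \<otimes> d) = x"
      using x y d by (simp add: mult_assoc)
    then have "x \<preceq> y \<otimes> d"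
      using x y d by (simp add: le_iff_left)
    then show ?thesis
      using x y d by (simp add: le_mult_idem_iff)
  qed
  from this[OF x y eq] this[OF y x eq[symmetric]] show ?thesis
    using x y by (intro le_antisym)
qed

text \<open>
  The element sought is the orthogonal join of the family, formed by adding one member at a time. The
  partial joins vanish on all atoms that have not been treated yet, which provides the orthogonality
  for the next step.
\<close>

lemma glue_atoms:
  assumes w: "\<And>a. a \<in> atoms \<Longrightarrow> w a \<in> carrier S" "\<And>a. a \<in> atoms \<Longrightarrow> w a \<otimes> a = w a"
    and orth: "\<And>a b. \<lbrakk>a \<in> atoms; b \<in> atoms; a \<noteq> b\<rbrakk> \<Longrightarrow> (w a)\<^sup>\<star> \<otimes> w b = \<^bold>0"
  obtains x where "x \<in> carrier S" "\<And>a. a \<in> atoms \<Longrightarrow> x \<otimes> a = w a"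
proof -
  have "\<exists>x\<in>carrier S. \<forall>a\<in>atoms. x \<otimes> a = (if a \<in> A then w a else \<^bold>0)"
    if "finite A" "A \<subseteq> atoms" for A
    using that
  proof (induction A)
    case empty
    show ?case
      by (intro bexI[of _ "\<^bold>0"]) simp_all
  next
    case (insert c A)
    then obtain x where x: "x \<in> carrier S"
      and xa: "\<And>a. a \<in> atoms \<Longrightarrow> x \<otimes> a = (if a \<in> A then w a else \<^bold>0)"
      by auto
    have c: "c \<in> atoms" "w c \<in> carrier S" "w c \<otimes> c = w c"
      using insert.prems w by auto
    have wc: "w c \<otimes> a = \<^bold>0" if "a \<in> atoms" "a \<noteq> c" for a
    proof -
      show ?thesis
        using that c atoms_orthogonal[of c a] mult_assoc[of "w c" c a] by simp
    qed
    (* The product with the partial join x is tested atom by atom, where x is known. *)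
    have "(w c)\<^sup>\<star> \<otimes> x = \<^bold>0"
    proof (rule eq_zero_if_atoms)
      fix a assume a: "a \<in> atoms"
      then show "(w c)\<^sup>\<star> \<otimes> x \<otimes> a = \<^bold>0"
        using x c xa[OF a] orth[OF c(1) a] insert.hyps by (cases "a = c") (auto simp: mult_assoc)
    qed (use x c in simp)
    then have "((w c)\<^sup>\<star> \<otimes> x)\<^sup>\<star> = \<^bold>0"
      by simp
    then have orth1: "x\<^sup>\<star> \<otimes> w c = \<^bold>0"
      using x c by (simp only: sinv_mult sinv_sinv sinv_closed)
    have "x \<otimes> (w c)\<^sup>\<star> = x \<otimes> (w c \<otimes> c)\<^sup>\<star>"
      using c by simp
    also have "\<dots> = x \<otimes> c \<otimes> (w c)\<^sup>\<star>"
      using c x sinv_mult[of "w c" c] by (simp add: mult_assoc del: c(3))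
    also have "\<dots> = \<^bold>0"
      using xa[OF c(1)] c insert.hyps by simp
    finally have orth2: "x \<otimes> (w c)\<^sup>\<star> = \<^bold>0" .
    obtain s where s: "s \<in> carrier S" "x \<preceq> s" "w c \<preceq> s"
      and least: "\<And>u. \<lbrakk>u \<in> carrier S; x \<preceq> u; w c \<preceq> u\<rbrakk> \<Longrightarrow> s \<preceq> u"
      by (rule orthogonal_join[OF x c(2) orth1 orth2]) blast
    have "s \<otimes> a = (if a \<in> insert c A then w a else \<^bold>0)" if a: "a \<in> atoms" for a
    proof -
      consider "x \<otimes> a \<noteq> \<^bold>0" | "w c \<otimes> a \<noteq> \<^bold>0" | "x \<otimes> a = \<^bold>0" "w c \<otimes> a = \<^bold>0"
        by blast
      then show ?thesis
      proof cases
        case 1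
        then have "s \<otimes> a = x \<otimes> a"
          using le_mult_atom[of x s a] x s a by blast
        then show ?thesis
          using xa[OF a] 1 by (auto split: if_splits)
      next
        case 2
        then have "s \<otimes> a = w c \<otimes> a" "a = c"
          using le_mult_atom[of "w c" s a] wc[of a] c s a by blast+
        then show ?thesis
          using c by simp
      next
        case 3
        then have "s \<otimes> a = \<^bold>0"
          using lub_mult_eq_zero[of x "w c" s a] x c s a least by simp
        then show ?thesis
          using 3 xa[OF a] c by (auto split: if_splits)
      qed
    qed
    then show ?case
      using s by blast
  qed
  from this[OF finite_atoms] show thesis
    using that by auto
qed

section \<open>Classes of related atoms\<close>

definition atom_rel :: "('a \<times> 'a) set" where
  "atom_rel = {(a, b). a \<in> atoms \<and> b \<in> atoms \<and>
    (\<exists>x\<in>carrier S. x\<^sup>\<star> \<otimes> x = a \<and> x \<otimes> x\<^sup>\<star> = b)}"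

lemma atom_relI:
  "\<lbrakk>x \<in> carrier S; x\<^sup>\<star> \<otimes> x \<in> atoms; x \<otimes> x\<^sup>\<star> \<in> atoms\<rbrakk> \<Longrightarrow> (x\<^sup>\<star> \<otimes> x, x \<otimes> x\<^sup>\<star>) \<in> atom_rel"
  by (auto simp: atom_rel_def)

lemma equiv_atom_rel: "equiv atoms atom_rel"
proof (rule equivI)
  show "atom_rel \<subseteq> atoms \<times> atoms"
    by (auto simp: atom_rel_def)
  show "refl_on atoms atom_rel"
  proof (rule refl_onI)
    fix a assume "a \<in> atoms"
    then show "(a, a) \<in> atom_rel"
      using atom_relI[of a] by simp
  qed
  show "sym atom_rel"
  proof (rule symI)
    fix a b
    assume "(a, b) \<in> atom_rel"
    then obtain x where "x \<in> carrier S" "x\<^sup>\<star> \<otimes> x = a" "x \<otimes> x\<^sup>\<star> = b" "a \<in> atoms" "b \<in> atoms"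
      by (auto simp: atom_rel_def)
    then show "(b, a) \<in> atom_rel"
      using atom_relI[of "x\<^sup>\<star>"] by simp
  qed
  show "trans atom_rel"
  proof (rule transI)
    fix a b c
    assume "(a, b) \<in> atom_rel" "(b, c) \<in> atom_rel"
    then obtain x y where x: "x \<in> carrier S" "x\<^sup>\<star> \<otimes> x = a" "x \<otimes> x\<^sup>\<star> = b"
      and y: "y \<in> carrier S" "y\<^sup>\<star> \<otimes> y = b" "y \<otimes> y\<^sup>\<star> = c" and "a \<in> atoms" "c \<in> atoms"
      by (auto simp: atom_rel_def)
    moreover have "(y \<otimes> x)\<^sup>\<star> \<otimes> (y \<otimes> x) = x\<^sup>\<star> \<otimes> b \<otimes> x"
      using x(1) y(1) by (simp add: sinv_mult mult_assoc flip: y(2))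
    moreover have "x\<^sup>\<star> \<otimes> b \<otimes> x = a"
      using x(1) by (simp add: normal_simps flip: x(2,3))
    moreover have "(y \<otimes> x) \<otimes> (y \<otimes> x)\<^sup>\<star> = y \<otimes> b \<otimes> y\<^sup>\<star>"
      using x(1) y(1) by (simp add: sinv_mult mult_assoc flip: x(3))
    moreover have "y \<otimes> b \<otimes> y\<^sup>\<star> = c"
      using y(1) by (simp add: normal_simps flip: y(2,3))
    ultimately show "(a, c) \<in> atom_rel"
      by (auto simp: atom_rel_def intro!: bexI[of _ "y \<otimes> x"])
  qed
qed

lemma atom_image_rel:
  assumes x: "x \<in> carrier S" and a: "a \<in> atoms" and nz: "x \<otimes> a \<noteq> \<^bold>0"
  shows "(a, (x \<otimes> a) \<otimes> (x \<otimes> a)\<^sup>\<star>) \<in> atom_rel"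
  using atom_ran[OF assms] atom_dom_cases[OF x a] x a nz unfolding atom_rel_def by auto

text \<open>
  The idempotent \<open>e\<close> is the join of the atoms of \<open>C\<close>. It is central because \<open>e \<otimes> x\<close> and \<open>x \<otimes> e\<close> agree
  on every atom \<open>a\<close>: \<open>x \<otimes> a\<close> is zero or has as its range an atom that is related to \<open>a\<close>, and
  thus belongs to \<open>C\<close> just when \<open>a\<close> does.
\<close>

lemma class_idem:
  assumes C: "C \<in> atoms // atom_rel"
  obtains e where "e \<in> E" "\<And>a. a \<in> atoms \<Longrightarrow> e \<otimes> a = (if a \<in> C then a else \<^bold>0)"
    "\<And>x. x \<in> carrier S \<Longrightarrow> e \<otimes> x = x \<otimes> e"
proof -
  obtain e where e: "e \<in> carrier S"
    and ea: "\<And>a. a \<in> atoms \<Longrightarrow> e \<otimes> a = (if a \<in> C then a else \<^bold>0)"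
    by (rule glue_atoms[of "\<lambda>a. if a \<in> C then a else \<^bold>0"]) (auto simp: atoms_orthogonal)
  have comm: "e \<otimes> x = x \<otimes> e" if x: "x \<in> carrier S" for x
  proof (rule eq_if_atoms)
    fix a assume a: "a \<in> atoms"
    show "e \<otimes> x \<otimes> a = x \<otimes> e \<otimes> a"
    proof (cases "x \<otimes> a = \<^bold>0")
      case True
      then show ?thesis
        using e x a by (simp add: mult_assoc ea)
    next
      case False
      then obtain b where b: "b \<in> atoms" "b \<otimes> (x \<otimes> a) = x \<otimes> a" "(a, b) \<in> atom_rel"
        using atom_image_rel[OF x a] atom_image[OF x a] by metis
      have "a \<in> C \<longleftrightarrow> b \<in> C"
        using quotient_eq_iff[OF equiv_atom_rel C C] b(3)
          in_quotient_imp_closed[OF equiv_atom_rel C] equivE[OF equiv_atom_rel] by (metis symD)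
      moreover have "e \<otimes> (x \<otimes> a) = (e \<otimes> b) \<otimes> (x \<otimes> a)"
        using a b e x mult_assoc[of e b "x \<otimes> a"] by simp
      ultimately show ?thesis
        using a b e x by (simp add: mult_assoc ea)
    qed
  qed (use e x in auto)
  have "e \<otimes> e = e"
  proof (rule eq_if_atoms)
    fix a assume "a \<in> atoms"
    then show "e \<otimes> e \<otimes> a = e \<otimes> a"
      using e by (simp add: mult_assoc ea)
  qed (use e in auto)
  then have "e \<in> E"
    using e by (simp add: idemI)
  then show thesis
    using that ea comm by blast
qed

end

section \<open>Rook matrices over a group with zero\<close>

lemma adjoin_zero_sel [simp]:
  "None \<in> carrier (adjoin_zero G)"
  "Some g \<in> carrier (adjoin_zero G) \<longleftrightarrow> g \<in> carrier G"
  "None \<otimes>\<^bsub>adjoin_zero G\<^esub> x = None"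
  "x \<otimes>\<^bsub>adjoin_zero G\<^esub> None = None"
  "Some g \<otimes>\<^bsub>adjoin_zero G\<^esub> Some h = Some (g \<otimes>\<^bsub>G\<^esub> h)"
  by (auto simp: adjoin_zero_def split: option.splits)

lemma semigroup_zero_adjoin_zero [simp]: "semigroup_zero (adjoin_zero G) = None"
  unfolding semigroup_zero_def
proof (rule the_equality)
  show "is_zero (adjoin_zero G) None"
    by (simp add: is_zero_def)
  show "z = None" if "is_zero (adjoin_zero G) z" for z
    using that unfolding is_zero_def by (metis adjoin_zero_sel(1,4))
qed

context group
begin

lemma semigroup_inv_adjoin_zero:
  assumes x: "x \<in> carrier (adjoin_zero G)"
  shows "semigroup_inv (adjoin_zero G) x = map_option (m_inv G) x"
  unfolding semigroup_inv_def
proof (rule the_equality)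
  show "map_option (m_inv G) x \<in> carrier (adjoin_zero G) \<and>
      x = x \<otimes>\<^bsub>adjoin_zero G\<^esub> map_option (m_inv G) x \<otimes>\<^bsub>adjoin_zero G\<^esub> x \<and>
      map_option (m_inv G) x =
        map_option (m_inv G) x \<otimes>\<^bsub>adjoin_zero G\<^esub> x \<otimes>\<^bsub>adjoin_zero G\<^esub> map_option (m_inv G) x"
    using x by (cases x) auto
  fix y
  assume y: "y \<in> carrier (adjoin_zero G) \<and> x = x \<otimes>\<^bsub>adjoin_zero G\<^esub> y \<otimes>\<^bsub>adjoin_zero G\<^esub> x \<and>
      y = y \<otimes>\<^bsub>adjoin_zero G\<^esub> x \<otimes>\<^bsub>adjoin_zero G\<^esub> y"
  show "y = map_option (m_inv G) x"
  proof (cases x)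
    case None
    then show ?thesis
      using y by simp
  next
    case (Some g)
    then obtain h where h: "y = Some h"
      using y by (cases y) auto
    have "g \<in> carrier G" "h \<in> carrier G" "g \<otimes> h \<otimes> g = g"
      using x y by (simp_all add: Some h)
    then have "g \<otimes> h = \<one>"
      by (metis l_cancel_one' m_closed r_cancel_one')
    then show ?thesis
      using \<open>g \<in> carrier G\<close> \<open>h \<in> carrier G\<close> inv_equality[of h g] inv_comm[of g h] by (simp add: Some h)
  qed
qed

lemma orthogonality_adjoin_zero:
  assumes "x \<in> carrier (adjoin_zero G)" "y \<in> carrier (adjoin_zero G)"
  shows "semigroup_inv (adjoin_zero G) x \<otimes>\<^bsub>adjoin_zero G\<^esub> y = None \<longleftrightarrow> x = None \<or> y = None"
    and "x \<otimes>\<^bsub>adjoin_zero G\<^esub> semigroup_inv (adjoin_zero G) y = None \<longleftrightarrow> x = None \<or> y = None"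
  using assms by (cases x; cases y; simp add: semigroup_inv_adjoin_zero)+

lemma natural_order_adjoin_zero:
  assumes "x \<in> carrier (adjoin_zero G)" "y \<in> carrier (adjoin_zero G)"
  shows "x \<sqsubseteq>\<^bsub>natural_order (adjoin_zero G)\<^esub> y \<longleftrightarrow> x = None \<or> x = y"
  using assms by (cases x; cases y) (auto simp: natural_order_def semigroup_inv_adjoin_zero m_assoc)

text \<open>
  Zero lies below everything and distinct group elements are incomparable, so the joins in
  a product of rook matrices merely select the one term that may be nonzero.
\<close>

lemma sup_adjoin_zero:
  assumes v: "v \<in> carrier (adjoin_zero G)" "v \<in> A" and A: "A \<subseteq> {None, v}"
  shows "\<Squnion>\<^bsub>natural_order (adjoin_zero G)\<^esub> A = v"
proof -
  have car: "carrier (natural_order (adjoin_zero G)) = carrier (adjoin_zero G)"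
    by (simp add: natural_order_def)
  have least: "is_lub (natural_order (adjoin_zero G)) v A"
    using v A by (auto simp: least_def Upper_def car natural_order_adjoin_zero)
  moreover have "u = v" if "is_lub (natural_order (adjoin_zero G)) u A" for u
  proof -
    have "u \<in> carrier (adjoin_zero G)" "u \<sqsubseteq>\<^bsub>natural_order (adjoin_zero G)\<^esub> v"
        "v \<sqsubseteq>\<^bsub>natural_order (adjoin_zero G)\<^esub> u"
      using that least by (auto simp: least_def car)
    then have "u = None \<or> u = v" "v = None \<or> v = u"
      using v by (simp_all add: natural_order_adjoin_zero)
    then show ?thesis
      by auto
  qed
  ultimately show ?thesis
    unfolding Lattice.sup_def by (rule some_equality)
qed

lemma carrier_rook_matrices_adjoin_zero:
  "x \<in> carrier (rook_matrices n (adjoin_zero G)) \<longleftrightarrow>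
    x \<in> carrier_mat n n \<and> (\<forall>i<n. \<forall>j<n. x $$ (i, j) \<in> carrier (adjoin_zero G)) \<and>
    (\<forall>i<n. \<forall>j<n. \<forall>k<n. j \<noteq> k \<longrightarrow>
      (x $$ (i, j) = None \<or> x $$ (i, k) = None) \<and> (x $$ (j, i) = None \<or> x $$ (k, i) = None))"
proof (cases "\<forall>i<n. \<forall>j<n. x $$ (i, j) \<in> carrier (adjoin_zero G)")
  case True
  then show ?thesis
    by (simp add: rook_matrices_def orthogonality_adjoin_zero)
next
  case False
  then show ?thesis
    by (simp add: rook_matrices_def) blast
qed

lemma rook_mult_entry:
  assumes "i < n" "j < n"
    and v: "v \<in> carrier (adjoin_zero G)" "l < n" "x $$ (i, l) \<otimes>\<^bsub>adjoin_zero G\<^esub> y $$ (l, j) = v"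
    and others: "\<And>k. \<lbrakk>k < n; k \<noteq> l\<rbrakk> \<Longrightarrow> x $$ (i, k) \<otimes>\<^bsub>adjoin_zero G\<^esub> y $$ (k, j) = None"
  shows "(x \<otimes>\<^bsub>rook_matrices n (adjoin_zero G)\<^esub> y) $$ (i, j) = v"
proof -
  have "\<Squnion>\<^bsub>natural_order (adjoin_zero G)\<^esub>
      {x $$ (i, k) \<otimes>\<^bsub>adjoin_zero G\<^esub> y $$ (k, j) | k. k < n} = v"
  proof (rule sup_adjoin_zero[OF v(1)])
    show "v \<in> {x $$ (i, k) \<otimes>\<^bsub>adjoin_zero G\<^esub> y $$ (k, j) | k. k < n}"
      by (intro CollectI exI[of _ l]) (simp add: v)
    show "{x $$ (i, k) \<otimes>\<^bsub>adjoin_zero G\<^esub> y $$ (k, j) | k. k < n} \<subseteq> {None, v}"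
    proof
      fix u assume "u \<in> {x $$ (i, k) \<otimes>\<^bsub>adjoin_zero G\<^esub> y $$ (k, j) | k. k < n}"
      then obtain k where "k < n" "u = x $$ (i, k) \<otimes>\<^bsub>adjoin_zero G\<^esub> y $$ (k, j)"
        by blast
      then show "u \<in> {None, v}"
        using v(3) others[of k] by (cases "k = l") simp_all
    qed
  qed
  then show ?thesis
    using assms(1,2) by (simp add: rook_matrices_def)
qed

text \<open>
  If \<open>x\<close> is idempotent and \<open>x $$ (i, j)\<close> is not zero then the only term that can contribute to it is
  \<open>x $$ (i, j) \<otimes> x $$ (j, j)\<close>. As a column has at most one nonzero entry, \<open>i = j\<close>, and the entry
  is an idempotent of the group.
\<close>

lemma rook_idempotent_entry:
  assumes x: "x \<in> idempotents (rook_matrices n (adjoin_zero G))" and ij: "i < n" "j < n"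
  shows "x $$ (i, j) \<in> {None, Some \<one>}"
proof (cases "x $$ (i, j)")
  case (Some g)
  have xx: "x \<otimes>\<^bsub>rook_matrices n (adjoin_zero G)\<^esub> x = x"
    and x: "x \<in> carrier (rook_matrices n (adjoin_zero G))"
    using x by (auto simp: idempotents_def)
  have row: "x $$ (i, k) = None" if "k < n" "k \<noteq> j" for k
    using x that ij Some unfolding carrier_rook_matrices_adjoin_zero by (metis option.distinct(1))
  have g: "g \<in> carrier G" and c: "x $$ (j, j) \<in> carrier (adjoin_zero G)"
    using x ij Some unfolding carrier_rook_matrices_adjoin_zero by (metis adjoin_zero_sel(2))+
  have "x $$ (i, j) \<otimes>\<^bsub>adjoin_zero G\<^esub> x $$ (j, j) \<in> carrier (adjoin_zero G)"
    using c g by (cases "x $$ (j, j)") (auto simp: Some)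
  then have "(x \<otimes>\<^bsub>rook_matrices n (adjoin_zero G)\<^esub> x) $$ (i, j)
      = x $$ (i, j) \<otimes>\<^bsub>adjoin_zero G\<^esub> x $$ (j, j)"
    using ij row by (intro rook_mult_entry[of i n j _ j]) auto
  then have eq: "Some g \<otimes>\<^bsub>adjoin_zero G\<^esub> x $$ (j, j) = Some g"
    by (simp add: xx Some)
  then have "x $$ (j, j) \<noteq> None"
    by (cases "x $$ (j, j)") simp_all
  then have "i = j"
    using x ij Some unfolding carrier_rook_matrices_adjoin_zero by (metis option.distinct(1))
  then have "g \<otimes> g = g"
    using eq Some by simp
  then show ?thesis
    using g Some by (simp add: l_cancel_one')
qed simp

lemma finite_idempotents_rook_matrices:
  "finite (idempotents (rook_matrices n (adjoin_zero G)))"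
proof -
  let ?I = "{..<n} \<times> {..<n}"
  have "idempotents (rook_matrices n (adjoin_zero G)) \<subseteq> mat n n ` (?I \<rightarrow>\<^sub>E {None, Some \<one>})"
  proof
    fix x assume x: "x \<in> idempotents (rook_matrices n (adjoin_zero G))"
    then have "x \<in> carrier_mat n n"
      by (simp add: idempotents_def carrier_rook_matrices_adjoin_zero)
    then have "x = mat n n (restrict (\<lambda>ij. x $$ ij) ?I)"
      by (intro eq_matI) auto
    moreover have "restrict (\<lambda>ij. x $$ ij) ?I \<in> ?I \<rightarrow>\<^sub>E {None, Some \<one>}"
      unfolding restrict_PiE_iff
    proof
      fix ij assume "ij \<in> ?I"
      then show "x $$ ij \<in> {None, Some \<one>}"
        using rook_idempotent_entry[OF x, of "fst ij" "snd ij"] by (cases ij) simp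
    qed
    ultimately show "x \<in> mat n n ` (?I \<rightarrow>\<^sub>E {None, Some \<one>})"
      by blast
  qed
  moreover have "finite (?I \<rightarrow>\<^sub>E {None, Some \<one>})"
    by (intro finite_PiE) auto
  ultimately show ?thesis
    by (meson finite_imageI finite_subset)
qed

end

section \<open>Finiteness of the idempotents of a product\<close>

lemma idempotents_iso_image:
  assumes h: "h \<in> iso M N"
  shows "h ` idempotents M \<subseteq> idempotents N"
proof
  fix y assume "y \<in> h ` idempotents M"
  then obtain x where "x \<in> carrier M" "x \<otimes>\<^bsub>M\<^esub> x = x" "y = h x"
    by (auto simp: idempotents_def)
  then show "y \<in> idempotents N"
    using h hom_mult[of h M N x x] hom_in_carrier[of h M N x] by (auto simp: iso_def idempotents_def)
qed

lemma finite_idempotents_iso: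
  assumes "M \<cong> N" "finite (idempotents N)"
  shows "finite (idempotents M)"
proof -
  obtain h where h: "h \<in> iso M N"
    using assms by (auto simp: is_iso_def)
  have "inj_on h (idempotents M)"
    using h by (auto simp: iso_def bij_betw_def idempotents_def intro: inj_on_subset)
  moreover have "finite (h ` idempotents M)"
    using idempotents_iso_image[OF h] assms(2) by (rule finite_subset)
  ultimately show ?thesis
    by (rule finite_imageD[rotated])
qed

lemma finite_idempotents_product_group:
  assumes "finite I" "\<And>i. i \<in> I \<Longrightarrow> finite (idempotents (T i))"
  shows "finite (idempotents (product_group I T))"
proof (rule finite_subset)
  show "idempotents (product_group I T) \<subseteq> (\<Pi>\<^sub>E i\<in>I. idempotents (T i))"
    by (auto simp: idempotents_def PiE_iff fun_eq_iff restrict_def)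
  show "finite (\<Pi>\<^sub>E i\<in>I. idempotents (T i))"
    using assms by (intro finite_PiE) auto
qed

lemma finite_idempotents_if_finite_product:
  fixes S :: "('a, 'm) monoid_scheme"
  assumes "finite_product_of_fully_group_matricial TYPE('b) TYPE('g) S"
  shows "finite (idempotents S)"
proof -
  obtain k and T :: "nat \<Rightarrow> 'b monoid"
    where T: "\<And>i. i < k \<Longrightarrow> fully_group_matricial TYPE('g) (T i)" and S: "S \<cong> product_group {..<k} T"
    using assms unfolding finite_product_of_fully_group_matricial_def by blast
  have "finite (idempotents (T i))" if "i < k" for i
    using T[OF that] group.finite_idempotents_rook_matrices finite_idempotents_iso
    unfolding fully_group_matricial_def by metis
  then have "finite (idempotents (product_group {..<k} T))"
    by (intro finite_idempotents_product_group) auto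
  with S show ?thesis
    by (rule finite_idempotents_iso)
qed

section \<open>Coordinates when all atoms are related\<close>

definition maximal_subgroup :: "('a, 'm) monoid_scheme \<Rightarrow> 'a \<Rightarrow> 'a monoid" where
  "maximal_subgroup S e =
    \<lparr>carrier = {x \<in> carrier S.
       semigroup_inv S x \<otimes>\<^bsub>S\<^esub> x = e \<and> x \<otimes>\<^bsub>S\<^esub> semigroup_inv S x = e},
     monoid.mult = (\<otimes>\<^bsub>S\<^esub>),
     one = e\<rparr>"

lemma maximal_subgroup_sel [simp]:
  "x \<in> carrier (maximal_subgroup S e) \<longleftrightarrow>
    x \<in> carrier S \<and> semigroup_inv S x \<otimes>\<^bsub>S\<^esub> x = e \<and> x \<otimes>\<^bsub>S\<^esub> semigroup_inv S x = e"
  "x \<otimes>\<^bsub>maximal_subgroup S e\<^esub> y = x \<otimes>\<^bsub>S\<^esub> y"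
  "\<one>\<^bsub>maximal_subgroup S e\<^esub> = e"
  by (simp_all add: maximal_subgroup_def)

lemma (in inverse_semigroup) group_maximal_subgroup:
  assumes e: "e \<in> E"
  shows "group (maximal_subgroup S e)"
proof (rule groupI)
  fix x assume x: "x \<in> carrier (maximal_subgroup S e)"
  then have x': "x \<in> carrier S" "x\<^sup>\<star> \<otimes> x = e" "x \<otimes> x\<^sup>\<star> = e"
    by auto
  show "\<one>\<^bsub>maximal_subgroup S e\<^esub> \<otimes>\<^bsub>maximal_subgroup S e\<^esub> x = x"
    using x' mult_sinv_mult[of x] by simp
  show "\<exists>y\<in>carrier (maximal_subgroup S e). y \<otimes>\<^bsub>maximal_subgroup S e\<^esub> x = \<one>\<^bsub>maximal_subgroup S e\<^esub>"
    using x' by (intro bexI[of _ "x\<^sup>\<star>"]) auto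
  fix y assume y: "y \<in> carrier (maximal_subgroup S e)"
  then have y': "y \<in> carrier S" "y\<^sup>\<star> \<otimes> y = e" "y \<otimes> y\<^sup>\<star> = e"
    by auto
  have "(x \<otimes> y)\<^sup>\<star> \<otimes> (x \<otimes> y) = y\<^sup>\<star> \<otimes> (x\<^sup>\<star> \<otimes> x) \<otimes> y"
    using x'(1) y'(1) by (simp add: sinv_mult mult_assoc)
  also have "\<dots> = y\<^sup>\<star> \<otimes> (y \<otimes> y\<^sup>\<star>) \<otimes> y"
    by (simp only: x' y')
  also have "\<dots> = e"
    using y'(1) by (simp add: normal_simps flip: y'(2))
  finally have 1: "(x \<otimes> y)\<^sup>\<star> \<otimes> (x \<otimes> y) = e" .
  have "(x \<otimes> y) \<otimes> (x \<otimes> y)\<^sup>\<star> = x \<otimes> (y \<otimes> y\<^sup>\<star>) \<otimes> x\<^sup>\<star>"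
    using x'(1) y'(1) by (simp add: sinv_mult mult_assoc)
  also have "\<dots> = x \<otimes> (x\<^sup>\<star> \<otimes> x) \<otimes> x\<^sup>\<star>"
    by (simp only: x' y')
  also have "\<dots> = e"
    using x'(1) by (simp add: normal_simps flip: x'(3))
  finally show "x \<otimes>\<^bsub>maximal_subgroup S e\<^esub> y \<in> carrier (maximal_subgroup S e)"
    using 1 x' y' by simp
qed (use e in \<open>auto simp: mult_assoc\<close>)

text \<open>
  The atom \<open>u\<close> serves as a base point, \<open>c\<close> numbers the atoms and \<open>p i\<close> leads from \<open>u\<close> to \<open>c i\<close>.
  The products \<open>p i \<otimes> (p j)\<^sup>\<star>\<close> behave like matrix units.
\<close>

locale atom_coordinates = finite_boolean_inverse_monoid +
  fixes n :: nat and c p :: "nat \<Rightarrow> 'a" and u :: 'a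
  assumes base: "u \<in> atoms"
    and bij: "bij_betw c {..<n} atoms"
    and p_closed: "i < n \<Longrightarrow> p i \<in> carrier S"
    and p_dom: "i < n \<Longrightarrow> (p i)\<^sup>\<star> \<otimes> p i = u"
    and p_ran: "i < n \<Longrightarrow> p i \<otimes> (p i)\<^sup>\<star> = c i"
begin

abbreviation G :: "'a monoid" where
  "G \<equiv> maximal_subgroup S u"

sublocale G: group G
  using base by (intro group_maximal_subgroup) simp

declare p_closed [simp]

lemma c_atom [simp]: "i < n \<Longrightarrow> c i \<in> atoms"
  using bij by (auto simp: bij_betw_def)

lemma c_eq_iff: "\<lbrakk>i < n; j < n\<rbrakk> \<Longrightarrow> c i = c j \<longleftrightarrow> i = j"
  using bij by (auto simp: bij_betw_def inj_on_def)

lemma atom_is_c: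
  assumes "a \<in> atoms"
  obtains i where "i < n" "a = c i"
  using bij assms by (auto simp: bij_betw_def)

lemma p_absorb:
  assumes i: "i < n"
  shows "c i \<otimes> p i = p i" "p i \<otimes> u = p i" "(p i)\<^sup>\<star> \<otimes> c i = (p i)\<^sup>\<star>" "u \<otimes> (p i)\<^sup>\<star> = (p i)\<^sup>\<star>"
  using i by (simp_all add: normal_simps flip: p_dom[OF i] p_ran[OF i])

lemma p_orthogonal:
  assumes "i < n" "j < n" "i \<noteq> j"
  shows "(p i)\<^sup>\<star> \<otimes> p j = \<^bold>0"
proof -
  have "(p i)\<^sup>\<star> \<otimes> p j = (p i)\<^sup>\<star> \<otimes> (c i \<otimes> c j) \<otimes> p j"
    using assms p_absorb[of i] p_absorb[of j] by (metis atom_idem c_atom idem_closed mult_assoc mult_closed p_closed sinv_closed)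
  also have "\<dots> = \<^bold>0"
    using assms atoms_orthogonal[of "c i" "c j"] c_eq_iff by simp
  finally show ?thesis .
qed

definition entry :: "'a \<Rightarrow> nat \<Rightarrow> nat \<Rightarrow> 'a" where
  "entry x i j = (p i)\<^sup>\<star> \<otimes> (x \<otimes> p j)"

definition coordinates :: "'a \<Rightarrow> 'a option mat" where
  "coordinates x = mat n n (\<lambda>(i, j). if entry x i j = \<^bold>0 then None else Some (entry x i j))"

lemma entry_closed [simp]: "\<lbrakk>x \<in> carrier S; i < n; j < n\<rbrakk> \<Longrightarrow> entry x i j \<in> carrier S"
  by (simp add: entry_def)

lemma entry_sinv: "\<lbrakk>x \<in> carrier S; i < n; j < n\<rbrakk> \<Longrightarrow> entry (x\<^sup>\<star>) j i = (entry x i j)\<^sup>\<star>"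
  by (simp add: entry_def sinv_mult mult_assoc)

text \<open>
  The domain of the entry lies below the atom \<open>u\<close>, and so does its range, by the same argument for
  \<open>x\<^sup>\<star>\<close>. An entry is therefore zero or has \<open>u\<close> as its domain and its range.
\<close>

lemma entry_in_group:
  assumes x: "x \<in> carrier S" and ij: "i < n" "j < n" and nz: "entry x i j \<noteq> \<^bold>0"
  shows "entry x i j \<in> carrier G"
proof -
  have dom: "(entry x i j)\<^sup>\<star> \<otimes> entry x i j = u"
    if "x \<in> carrier S" "i < n" "j < n" "entry x i j \<noteq> \<^bold>0" for x i j
  proof -
    have "entry x i j \<otimes> u = entry x i j"
      using that base by (simp add: entry_def mult_assoc p_absorb)
    then show ?thesis
      using atom_dom_cases[of "entry x i j" u] that base by simp
  qed
  show ?thesis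
    using dom[OF assms] dom[of "x\<^sup>\<star>" j i] assms by (simp add: entry_sinv)
qed

text \<open>
  The entry and \<open>c i \<otimes> x \<otimes> c j\<close> determine each other, which translates between matrices and
  the action of \<open>x\<close> on the atoms.
\<close>

lemma entry_via_atoms:
  assumes x: "x \<in> carrier S" and ij: "i < n" "j < n"
  shows "entry x i j = (p i)\<^sup>\<star> \<otimes> (c i \<otimes> (x \<otimes> c j)) \<otimes> p j"
    and "p i \<otimes> entry x i j \<otimes> (p j)\<^sup>\<star> = c i \<otimes> (x \<otimes> c j)"
proof -
  have "(p i)\<^sup>\<star> \<otimes> (c i \<otimes> (x \<otimes> c j)) \<otimes> p j = ((p i)\<^sup>\<star> \<otimes> c i) \<otimes> (x \<otimes> (c j \<otimes> p j))"
    using assms by (simp add: mult_assoc)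
  then show "entry x i j = (p i)\<^sup>\<star> \<otimes> (c i \<otimes> (x \<otimes> c j)) \<otimes> p j"
    using assms by (simp add: p_absorb entry_def)
  show "p i \<otimes> entry x i j \<otimes> (p j)\<^sup>\<star> = c i \<otimes> (x \<otimes> c j)"
    using assms by (simp add: entry_def mult_assoc flip: p_ran)
qed

lemma entry_column_unique:
  assumes x: "x \<in> carrier S" and "i < n" "j < n" "k < n"
    and "entry x i k \<noteq> \<^bold>0" "entry x j k \<noteq> \<^bold>0"
  shows "i = j"
proof -
  have "c i \<otimes> (x \<otimes> c k) \<noteq> \<^bold>0" "c j \<otimes> (x \<otimes> c k) \<noteq> \<^bold>0"
    using assms by (auto simp: entry_via_atoms)
  then have "c i = c j"
    using atom_image_unique[of x "c k" "c i" "c j"] assms by simp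
  then show ?thesis
    using c_eq_iff assms by simp
qed

lemma coordinates_closed:
  assumes x: "x \<in> carrier S"
  shows "coordinates x \<in> carrier (rook_matrices n (adjoin_zero G))"
proof -
  have "i = j" if "i < n" "j < n" "k < n" "entry x k i \<noteq> \<^bold>0" "entry x k j \<noteq> \<^bold>0" for i j k
    using entry_column_unique[of "x\<^sup>\<star>" i j k] that x by (simp add: entry_sinv)
  moreover have "coordinates x \<in> carrier_mat n n"
    by (simp add: coordinates_def)
  ultimately show ?thesis
    using entry_in_group[OF x] entry_column_unique[OF x]
    unfolding G.carrier_rook_matrices_adjoin_zero
    by (auto simp: coordinates_def simp del: maximal_subgroup_sel(1))
qed

text \<open>
  Let \<open>c l\<close> be the range of \<open>y \<otimes> c j\<close>. In column \<open>j\<close> of the matrix of \<open>y\<close> only row \<open>l\<close> can be occupied, and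
  \<open>p l \<otimes> (p l)\<^sup>\<star> = c l\<close> can be inserted between \<open>x\<close> and \<open>y \<otimes> p j\<close>.
\<close>

lemma coordinates_mult:
  assumes x: "x \<in> carrier S" and y: "y \<in> carrier S"
  shows "coordinates (x \<otimes> y) =
    coordinates x \<otimes>\<^bsub>rook_matrices n (adjoin_zero G)\<^esub> coordinates y" (is "_ = ?R")
proof (rule eq_matI)
  fix i j assume "i < dim_row ?R" "j < dim_col ?R"
  then have ij: "i < n" "j < n"
    by (simp_all add: rook_matrices_def)
  obtain l where l: "l < n" and yl: "c l \<otimes> (y \<otimes> c j) = y \<otimes> c j"
  proof (cases "y \<otimes> c j = \<^bold>0")
    case True
    (* Column j of the matrix of y is zero, so any index would do. *)
    then show ?thesis
      using that[of j] ij by simp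
  next
    case False
    then show ?thesis
      using atom_image[OF y c_atom[OF ij(2)]] atom_is_c that by metis
  qed
  have others: "entry y k j = \<^bold>0" if k: "k < n" "k \<noteq> l" for k
  proof -
    have "c k \<otimes> (c l \<otimes> (y \<otimes> c j)) = (c k \<otimes> c l) \<otimes> (y \<otimes> c j)"
      using k l ij y by (simp add: mult_assoc)
    then have "c k \<otimes> (y \<otimes> c j) = \<^bold>0"
      using k l ij y yl atoms_orthogonal[of "c k" "c l"] by (simp add: c_eq_iff)
    then show ?thesis
      using k ij y by (simp add: entry_via_atoms(1))
  qed
  have split: "entry (x \<otimes> y) i j = entry x i l \<otimes> entry y l j"
  proof -
    have "entry x i l \<otimes> entry y l j = (p i)\<^sup>\<star> \<otimes> (x \<otimes> (p l \<otimes> entry y l j))"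
      using x y ij l by (simp add: entry_def mult_assoc)
    also have "p l \<otimes> entry y l j = (p l \<otimes> (p l)\<^sup>\<star>) \<otimes> (y \<otimes> (c j \<otimes> p j))"
      using y ij l by (simp add: entry_def mult_assoc p_absorb)
    also have "\<dots> = (c l \<otimes> (y \<otimes> c j)) \<otimes> p j"
      using y ij l by (simp add: p_ran mult_assoc)
    also have "\<dots> = y \<otimes> p j"
      using y ij l by (simp add: yl) (simp add: mult_assoc p_absorb)
    finally show ?thesis
      using x y ij by (simp add: entry_def mult_assoc)
  qed
  (* A product of nonzero entries belongs to the group, so no term is lost by reading 0 as None. *)
  have nz: "entry x i l \<otimes> entry y l j \<noteq> \<^bold>0" if "entry x i l \<noteq> \<^bold>0" "entry y l j \<noteq> \<^bold>0"
  proof -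
    have "entry x i l \<otimes> entry y l j \<in> carrier G"
      using G.m_closed[of "entry x i l" "entry y l j"] entry_in_group that x y ij l
      by (simp del: maximal_subgroup_sel(1))
    then show ?thesis
      using base atom_nonzero[of u] by auto
  qed
  have "?R $$ (i, j) = coordinates (x \<otimes> y) $$ (i, j)"
  proof (rule G.rook_mult_entry[OF ij _ l])
    show "coordinates (x \<otimes> y) $$ (i, j) \<in> carrier (adjoin_zero G)"
      using coordinates_closed[of "x \<otimes> y"] x y ij
      unfolding G.carrier_rook_matrices_adjoin_zero by simp
    show "coordinates x $$ (i, l) \<otimes>\<^bsub>adjoin_zero G\<^esub> coordinates y $$ (l, j)
        = coordinates (x \<otimes> y) $$ (i, j)"
      using ij l x y nz by (simp add: coordinates_def split)
    show "coordinates x $$ (i, k) \<otimes>\<^bsub>adjoin_zero G\<^esub> coordinates y $$ (k, j) = None"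
      if "k < n" "k \<noteq> l" for k
      using ij others[OF that] that by (simp add: coordinates_def)
  qed
  then show "coordinates (x \<otimes> y) $$ (i, j) = ?R $$ (i, j)"
    by simp
qed (simp_all add: coordinates_def rook_matrices_def)

text \<open>
  Equal matrices give \<open>b \<otimes> x \<otimes> a = b \<otimes> y \<otimes> a\<close> for all atoms \<open>a\<close> and \<open>b\<close>. The atoms on the right are
  removed by \<open>eq_if_atoms\<close>, those on the left by the same lemma applied to inverses.
\<close>

lemma inj_on_coordinates: "inj_on coordinates (carrier S)"
proof (rule inj_onI)
  fix x y assume x: "x \<in> carrier S" and y: "y \<in> carrier S" and eq: "coordinates x = coordinates y"
  have entry: "entry x i j = entry y i j" if "i < n" "j < n" for i j
    using arg_cong[OF eq, of "\<lambda>m. m $$ (i, j)"] that by (auto simp: coordinates_def split: if_splits)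
  have bxa: "b \<otimes> (x \<otimes> a) = b \<otimes> (y \<otimes> a)" if ab: "a \<in> atoms" "b \<in> atoms" for a b
  proof -
    obtain i where "i < n" "b = c i"
      using ab(2) by (rule atom_is_c)
    moreover obtain j where "j < n" "a = c j"
      using ab(1) by (rule atom_is_c)
    ultimately show ?thesis
      using entry_via_atoms(2)[OF x, of i j] entry_via_atoms(2)[OF y, of i j] entry by simp
  qed
  show "x = y"
  proof (rule eq_if_atoms[OF x y])
    fix a assume a: "a \<in> atoms"
    have "(x \<otimes> a)\<^sup>\<star> = (y \<otimes> a)\<^sup>\<star>"
    proof (rule eq_if_atoms)
      fix b assume b: "b \<in> atoms"
      have "(b \<otimes> (x \<otimes> a))\<^sup>\<star> = (b \<otimes> (y \<otimes> a))\<^sup>\<star>"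
        using bxa[OF a b] by simp
      then show "(x \<otimes> a)\<^sup>\<star> \<otimes> b = (y \<otimes> a)\<^sup>\<star> \<otimes> b"
        using a b x y sinv_mult[of b "x \<otimes> a"] sinv_mult[of b "y \<otimes> a"] by simp
    qed (use a x y in simp_all)
    then have "(x \<otimes> a)\<^sup>\<star>\<^sup>\<star> = (y \<otimes> a)\<^sup>\<star>\<^sup>\<star>"
      by (rule arg_cong)
    then show "x \<otimes> a = y \<otimes> a"
      using a x y by simp
  qed
qed

text \<open>
  Column \<open>j\<close> of the matrix prescribes the restriction \<open>w j\<close> of the preimage to the atom \<open>c j\<close>: it is
  \<open>p i \<otimes> g \<otimes> (p j)\<^sup>\<star>\<close> if \<open>g\<close> is the nonzero entry of the column, in row \<open>i\<close>, and zero if there is none.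
  Different columns have their entries in different rows, so these restrictions have orthogonal
  ranges and can be glued.
\<close>

lemma coordinates_surj:
  assumes m: "m \<in> carrier (rook_matrices n (adjoin_zero G))"
  obtains x where "x \<in> carrier S" "coordinates x = m"
proof -
  note m' = m[unfolded G.carrier_rook_matrices_adjoin_zero]
  have mat: "m \<in> carrier_mat n n"
    using m' by blast
  have G: "g \<in> carrier G" if "i < n" "j < n" "m $$ (i, j) = Some g" for i j g
    using m' that adjoin_zero_sel(2)[of g G] by metis
  note m'' = m'[THEN conjunct2, THEN conjunct2, rule_format]
  have row: "m $$ (i, k) = None" if "i < n" "j < n" "k < n" "j \<noteq> k" "m $$ (i, j) \<noteq> None" for i j k
    using m''[OF that(1-4)] that(5) by simp
  have col: "m $$ (k, i) = None" if "i < n" "j < n" "k < n" "j \<noteq> k" "m $$ (j, i) \<noteq> None" for i j k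
    using m''[OF that(1-4)] that(5) by simp
  have "\<exists>w. w \<in> carrier S \<and> w \<otimes> c j = w \<and> (\<forall>i<n. (p i)\<^sup>\<star> \<otimes> (w \<otimes> p j) =
      (case m $$ (i, j) of None \<Rightarrow> \<^bold>0 | Some g \<Rightarrow> g)) \<and>
      (w = \<^bold>0 \<or> (\<exists>i<n. m $$ (i, j) \<noteq> None \<and> c i \<otimes> w = w))" if j: "j < n" for j
  proof (cases "\<exists>i<n. m $$ (i, j) \<noteq> None")
    case False
    then show ?thesis
      using j by (intro exI[of _ "\<^bold>0"]) auto
  next
    case True
    then obtain i g where i: "i < n" "m $$ (i, j) = Some g"
      by auto
    then have g: "g \<in> carrier S" "u \<otimes> g = g" "g \<otimes> u = g"
      using G[OF i(1) j i(2)] mult_sinv_mult[of g] sinv_cancel(1)[of g] by auto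
    define w where "w = p i \<otimes> g \<otimes> (p j)\<^sup>\<star>"
    have w: "w \<in> carrier S"
      using i j g by (simp add: w_def)
    have wc: "w \<otimes> c j = w" "c i \<otimes> w = w"
      using i j g p_absorb(1)[of i] p_absorb(3)[of j]
      by (simp_all add: w_def mult_assoc) (metis atom_idem c_atom idem_closed mult_assoc mult_closed p_closed sinv_closed)
    have wp: "w \<otimes> p j = p i \<otimes> g"
      using i j g by (simp add: w_def mult_assoc p_dom)
    have "(p k)\<^sup>\<star> \<otimes> (w \<otimes> p j) = (case m $$ (k, j) of None \<Rightarrow> \<^bold>0 | Some g \<Rightarrow> g)" if k: "k < n" for k
    proof (cases "k = i")
      case True
      then show ?thesis
        using i g mult_assoc[of "(p i)\<^sup>\<star>" "p i" g] by (simp add: wp p_dom)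
    next
      case False
      then have "m $$ (k, j) = None"
        using col[of j i k] i j k by simp
      then show ?thesis
        using False i g k mult_assoc[of "(p k)\<^sup>\<star>" "p i" g] p_orthogonal[of k i] by (simp add: wp)
    qed
    then show ?thesis
      using w wc i by (intro exI[of _ w]) auto
  qed
  then obtain w where w: "\<And>j. j < n \<Longrightarrow> w j \<in> carrier S" "\<And>j. j < n \<Longrightarrow> w j \<otimes> c j = w j"
    and wp: "\<And>i j. \<lbrakk>j < n; i < n\<rbrakk> \<Longrightarrow>
      (p i)\<^sup>\<star> \<otimes> (w j \<otimes> p j) = (case m $$ (i, j) of None \<Rightarrow> \<^bold>0 | Some g \<Rightarrow> g)"
    and cw: "\<And>j. j < n \<Longrightarrow> w j = \<^bold>0 \<or> (\<exists>i<n. m $$ (i, j) \<noteq> None \<and> c i \<otimes> w j = w j)"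
    by metis
  have orth: "(w j)\<^sup>\<star> \<otimes> w k = \<^bold>0" if jk: "j < n" "k < n" "j \<noteq> k" for j k
  proof (cases "w j = \<^bold>0 \<or> w k = \<^bold>0")
    case True
    then show ?thesis
      using w jk by auto
  next
    case False
    then obtain i i' where i: "i < n" "m $$ (i, j) \<noteq> None" "c i \<otimes> w j = w j"
      and i': "i' < n" "m $$ (i', k) \<noteq> None" "c i' \<otimes> w k = w k"
      using cw jk by meson
    have "i \<noteq> i'"
      using row[of i j k] i i' jk by auto
    have "(w j)\<^sup>\<star> \<otimes> w k = (c i \<otimes> w j)\<^sup>\<star> \<otimes> (c i' \<otimes> w k)"
      using i i' by simp
    also have "\<dots> = (w j)\<^sup>\<star> \<otimes> ((c i \<otimes> c i') \<otimes> w k)"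
      using i(1) i'(1) w jk sinv_mult[of "c i" "w j"] by (simp only: idem_closed atom_idem c_atom idem_sinv mult_assoc sinv_closed mult_closed)
    also have "\<dots> = \<^bold>0"
      using atoms_orthogonal[of "c i" "c i'"] c_eq_iff i(1) i'(1) \<open>i \<noteq> i'\<close> w jk by simp
    finally show ?thesis .
  qed
  define ix where "ix = the_inv_into {..<n} c"
  have ix: "ix (c j) = j" if "j < n" for j
    using that bij by (auto simp: ix_def bij_betw_def intro: the_inv_into_f_f)
  obtain x where x: "x \<in> carrier S" and xa: "\<And>a. a \<in> atoms \<Longrightarrow> x \<otimes> a = w (ix a)"
  proof (rule glue_atoms[of "\<lambda>a. w (ix a)"])
    fix a assume "a \<in> atoms"
    then obtain j where j: "j < n" "a = c j"
      by (rule atom_is_c)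
    then show "w (ix a) \<in> carrier S" "w (ix a) \<otimes> a = w (ix a)"
      using w by (simp_all add: ix)
    fix b assume "b \<in> atoms" "a \<noteq> b"
    then obtain k where "k < n" "b = c k" "j \<noteq> k"
      using j by (metis atom_is_c)
    then show "(w (ix a))\<^sup>\<star> \<otimes> w (ix b) = \<^bold>0"
      using j orth by (simp add: ix)
  qed blast
  have "coordinates x = m"
  proof (rule eq_matI)
    fix i j assume "i < dim_row m" "j < dim_col m"
    then have ij: "i < n" "j < n"
      using mat by auto
    have "x \<otimes> p j = (x \<otimes> c j) \<otimes> p j"
      using x ij by (simp add: mult_assoc p_absorb)
    then have "entry x i j = (case m $$ (i, j) of None \<Rightarrow> \<^bold>0 | Some g \<Rightarrow> g)"
      using wp[of j i] xa[of "c j"] ij by (simp add: entry_def ix)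
    moreover have "g \<noteq> \<^bold>0" if "m $$ (i, j) = Some g" for g
      using G[OF ij that] atom_nonzero[OF base] by auto
    ultimately show "coordinates x $$ (i, j) = m $$ (i, j)"
      using ij by (auto simp: coordinates_def split: option.splits)
  qed (use mat in \<open>auto simp: coordinates_def\<close>)
  with x show thesis
    by (rule that)
qed

lemma iso_rook_matrices: "S \<cong> rook_matrices n (adjoin_zero G)"
proof -
  have "bij_betw coordinates (carrier S) (carrier (rook_matrices n (adjoin_zero G)))"
    using inj_on_coordinates coordinates_closed coordinates_surj
    by (auto simp: bij_betw_def image_iff) metis
  then have "coordinates \<in> iso S (rook_matrices n (adjoin_zero G))"
    using coordinates_closed coordinates_mult by (auto simp: iso_def hom_def)
  then show ?thesis
    by (auto simp: is_iso_def)
qed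

end

context finite_boolean_inverse_monoid
begin

theorem iso_rook_matrices_if_atoms_related:
  assumes ne: "atoms \<noteq> {}"
    and rel: "\<And>a b. \<lbrakk>a \<in> atoms; b \<in> atoms\<rbrakk> \<Longrightarrow> (a, b) \<in> atom_rel"
  shows "\<exists>n > 0. \<exists>G :: 'a monoid. group G \<and> S \<cong> rook_matrices n (adjoin_zero G)"
proof -
  obtain u where u: "u \<in> atoms"
    using ne by blast
  obtain c where c: "bij_betw c {..<card atoms} atoms"
    using ex_bij_betw_nat_finite[OF finite_atoms] by (auto simp: atLeast0LessThan)
  have "\<forall>i<card atoms. \<exists>p. p \<in> carrier S \<and> p\<^sup>\<star> \<otimes> p = u \<and> p \<otimes> p\<^sup>\<star> = c i"
  proof (intro allI impI)
    fix i assume "i < card atoms"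
    then have "(u, c i) \<in> atom_rel"
      using c u by (intro rel) (auto simp: bij_betw_def)
    then show "\<exists>p. p \<in> carrier S \<and> p\<^sup>\<star> \<otimes> p = u \<and> p \<otimes> p\<^sup>\<star> = c i"
      by (auto simp: atom_rel_def)
  qed
  then obtain p where p: "\<And>i. i < card atoms \<Longrightarrow> p i \<in> carrier S"
      "\<And>i. i < card atoms \<Longrightarrow> (p i)\<^sup>\<star> \<otimes> p i = u"
      "\<And>i. i < card atoms \<Longrightarrow> p i \<otimes> (p i)\<^sup>\<star> = c i"
    by metis
  interpret atom_coordinates S "card atoms" c p u
    by unfold_locales (use u c p in auto)
  have "card atoms > 0"
    using ne by (simp add: card_gt_0_iff)
  then show ?thesis
    using iso_rook_matrices G.is_group by blast
qed

section \<open>Decomposition into corners\<close>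

text \<open>
  The atoms of the corner are the atoms in \<open>C\<close>. They are related within the corner, because an
  element that leads from \<open>a\<close> to \<open>b\<close> equals \<open>b \<otimes> x \<otimes> a\<close> and so belongs to the corner.
\<close>

lemma fully_group_matricial_corner:
  assumes C: "C \<in> atoms // atom_rel" and e: "e \<in> E"
    and ea: "\<And>a. a \<in> atoms \<Longrightarrow> e \<otimes> a = (if a \<in> C then a else \<^bold>0)"
  shows "fully_group_matricial TYPE('a) (corner S e)"
proof -
  let ?T = "corner S e"
  interpret T: boolean_inverse_monoid ?T
    using e by (rule boolean_inverse_monoid_corner)
  have idem: "T.E = {f \<in> E. e \<otimes> f = f}"
    using e by (rule idempotents_corner)
  interpret T: finite_boolean_inverse_monoid ?T
    by unfold_locales (use finite_idem in \<open>simp add: idem\<close>)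
  have zero: "semigroup_zero ?T = \<^bold>0"
    using e by (intro T.semigroup_zeroI) (simp add: is_zero_def)
  have sub: "C \<subseteq> atoms"
    using C by (rule in_quotient_imp_subset[OF equiv_atom_rel])
  have atoms: "T.atoms = C"
  proof (intro Set.set_eqI iffI)
    fix a assume "a \<in> C"
    then show "a \<in> T.atoms"
      using sub ea[of a] atom_nonzero[of a] atom_cases[of a]
      by (intro T.atomI) (auto simp: idem zero)
  next
    fix a assume a: "a \<in> T.atoms"
    then have aE: "a \<in> E" "e \<otimes> a = a" "a \<noteq> \<^bold>0"
      using T.atom_idem[OF a] T.atom_nonzero[OF a] by (auto simp: idem zero)
    have "a \<in> atoms"
    proof (rule atomI)
      fix f assume f: "f \<in> E"
      then have "a \<otimes> (e \<otimes> f) = a \<otimes> f"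
        using aE e idem_commute[of e a] by (simp flip: mult_assoc)
      moreover have "e \<otimes> f \<in> T.E"
        using e f by (simp add: idem idem_cancel_left)
      ultimately show "a \<otimes> f = \<^bold>0 \<or> a \<otimes> f = a"
        using T.atom_cases[OF a, of "e \<otimes> f"] by (simp add: zero)
    qed (use aE in auto)
    then show "a \<in> C"
      using ea[of a] aE by (auto split: if_splits)
  qed
  have "(a, b) \<in> T.atom_rel" if ab: "a \<in> C" "b \<in> C" for a b
  proof -
    have "(a, b) \<in> atom_rel"
      using ab C quotient_eq_iff[OF equiv_atom_rel C C] by blast
    then obtain x where x: "x \<in> carrier S" "x\<^sup>\<star> \<otimes> x = a" "x \<otimes> x\<^sup>\<star> = b"
      by (auto simp: atom_rel_def)
    have a: "a \<in> E" "e \<otimes> a = a" and b: "b \<in> E" "e \<otimes> b = b"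
      using ab sub ea by auto
    have "e \<otimes> (b \<otimes> x) = b \<otimes> x" "x \<otimes> a \<otimes> e = x \<otimes> a"
      using x(1) a b e idem_commute[of a e] mult_assoc[of e b x] by (simp_all add: mult_assoc)
    moreover have "b \<otimes> x = x" "x \<otimes> a = x"
      using x(1) by (simp_all add: normal_simps flip: x(2,3))
    ultimately have "x \<in> carrier ?T"
      using x(1) by simp
    then show ?thesis
      using x ab T.atom_relI[of x] by (simp add: atoms corner_sinv[OF e])
  qed
  then show ?thesis
    using T.iso_rook_matrices_if_atoms_related T.boolean_inverse_monoid_axioms
      in_quotient_imp_non_empty[OF equiv_atom_rel C]
    by (simp add: fully_group_matricial_def atoms)
qed

text \<open>
  The factors are the corners at the central idempotents \<open>e i\<close> of the classes, and the isomorphism is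
  \<open>x \<mapsto> (e i \<otimes> x)\<^sub>i\<close>. Its inverse glues the restrictions that the components \<open>y i\<close> have on the
  atoms of the classes \<open>C i\<close>.
\<close>

theorem product_of_corners:
  "finite_product_of_fully_group_matricial TYPE('a) TYPE('a) S"
proof -
  let ?Q = "atoms // atom_rel"
  define k where "k = card ?Q"
  have "finite ?Q"
    by (rule finite_quotient) (auto simp: atom_rel_def)
  then obtain C where C: "bij_betw C {..<k} ?Q"
    using ex_bij_betw_nat_finite by (auto simp: k_def atLeast0LessThan)
  then have CQ: "C i \<in> ?Q" if "i < k" for i
    using that by (auto simp: bij_betw_def)
  have "\<forall>i<k. \<exists>e. e \<in> E \<and> (\<forall>a\<in>atoms. e \<otimes> a = (if a \<in> C i then a else \<^bold>0)) \<and>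
      (\<forall>x\<in>carrier S. e \<otimes> x = x \<otimes> e)"
    using class_idem[OF CQ] by metis
  then obtain e where e [simp]: "\<And>i. i < k \<Longrightarrow> e i \<in> E"
    and ea: "\<And>i a. \<lbrakk>i < k; a \<in> atoms\<rbrakk> \<Longrightarrow> e i \<otimes> a = (if a \<in> C i then a else \<^bold>0)"
    and central: "\<And>i x. \<lbrakk>i < k; x \<in> carrier S\<rbrakk> \<Longrightarrow> e i \<otimes> x = x \<otimes> e i"
    by metis
  have "\<forall>a\<in>atoms. \<exists>i<k. a \<in> C i"
  proof
    fix a assume "a \<in> atoms"
    then obtain D where "D \<in> ?Q" "a \<in> D"
      using Union_quotient[OF equiv_atom_rel] by blast
    then show "\<exists>i<k. a \<in> C i"
      using C by (auto simp: bij_betw_def)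
  qed
  (* The index of the class of an atom. *)
  then obtain ix where ix: "\<And>a. a \<in> atoms \<Longrightarrow> ix a < k" "\<And>a. a \<in> atoms \<Longrightarrow> a \<in> C (ix a)"
    by metis
  have ix_unique: "i = ix a" if "a \<in> atoms" "i < k" "a \<in> C i" for i a
  proof -
    have "C i = C (ix a)"
      using quotient_disj[OF equiv_atom_rel CQ[of i] CQ[of "ix a"]] that ix[of a] by auto
    then show ?thesis
      using C that ix by (auto simp: bij_betw_def dest: inj_onD)
  qed
  have ea': "e i \<otimes> a = (if i = ix a then a else \<^bold>0)" if "i < k" "a \<in> atoms" for i a
  proof (cases "i = ix a")
    case True
    then show ?thesis
      using ea[OF that] ix(2)[OF that(2)] by simp
  next
    case False
    then have "a \<notin> C i"
      using ix_unique that by blast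
    then show ?thesis
      using ea[OF that] False by simp
  qed
  have ez: "e i \<otimes> z \<otimes> a = (if i = ix a then z \<otimes> a else \<^bold>0)"
    if "i < k" "z \<in> carrier S" "a \<in> atoms" for i z a
    using that central[of i z] mult_assoc[of z "e i" a] by (simp add: ea')
  have e_orth: "e i \<otimes> e j = \<^bold>0" if "i < k" "j < k" "i \<noteq> j" for i j
    by (rule eq_zero_if_atoms) (use that in \<open>auto simp: mult_assoc ea'\<close>)
  define T where "T = (\<lambda>i. corner S (e i))"
  define h where "h = (\<lambda>x. \<lambda>i\<in>{..<k}. e i \<otimes> x)"
  have T_closed: "e i \<otimes> x \<in> carrier (T i)" if "i < k" "x \<in> carrier S" for i x
    using that central[of i "e i \<otimes> x"] by (simp add: T_def idem_cancel_left)
  have mult: "e i \<otimes> (x \<otimes> y) = (e i \<otimes> x) \<otimes> (e i \<otimes> y)"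
    if "i < k" "x \<in> carrier S" "y \<in> carrier S" for i x y
  proof -
    have "(e i \<otimes> x) \<otimes> (e i \<otimes> y) = e i \<otimes> (x \<otimes> e i) \<otimes> y"
      using that by (simp add: mult_assoc)
    also have "\<dots> = e i \<otimes> (x \<otimes> y)"
      using that by (simp add: mult_assoc idem_cancel_left flip: central)
    finally show ?thesis
      by simp
  qed
  have hom: "h \<in> hom S (product_group {..<k} T)"
  proof (rule homI)
    show "h x \<in> carrier (product_group {..<k} T)" if "x \<in> carrier S" for x
      using T_closed that by (simp add: h_def)
    show "h (x \<otimes> y) = h x \<otimes>\<^bsub>product_group {..<k} T\<^esub> h y"
      if "x \<in> carrier S" "y \<in> carrier S" for x y
      using mult that by (simp add: h_def T_def fun_eq_iff)
  qed
  have "inj_on h (carrier S)"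
  proof (rule inj_onI)
    fix x y assume x: "x \<in> carrier S" and y: "y \<in> carrier S" and "h x = h y"
    then have eq: "e i \<otimes> x = e i \<otimes> y" if "i < k" for i
      using that by (auto simp: h_def dest: fun_cong[of _ _ i])
    show "x = y"
    proof (rule eq_if_atoms[OF x y])
      fix a assume a: "a \<in> atoms"
      show "x \<otimes> a = y \<otimes> a"
        using ez[OF ix(1)[OF a] x a] ez[OF ix(1)[OF a] y a] eq[OF ix(1)[OF a]] by simp
    qed
  qed
  moreover have "\<exists>x\<in>carrier S. h x = y" if y: "y \<in> carrier (product_group {..<k} T)" for y
  proof -
    have yi: "y i \<in> carrier S" "e i \<otimes> y i = y i" "y i \<otimes> e i = y i" if "i < k" for i
      using y that by (auto simp: T_def PiE_iff)
    obtain x where x: "x \<in> carrier S" and xa: "\<And>a. a \<in> atoms \<Longrightarrow> x \<otimes> a = y (ix a) \<otimes> a"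
    proof (rule glue_atoms[of "\<lambda>a. y (ix a) \<otimes> a"])
      fix a assume a: "a \<in> atoms"
      then show "y (ix a) \<otimes> a \<in> carrier S" "y (ix a) \<otimes> a \<otimes> a = y (ix a) \<otimes> a"
        using yi ix by (simp_all add: mult_assoc)
      fix b assume b: "b \<in> atoms" "a \<noteq> b"
      show "(y (ix a) \<otimes> a)\<^sup>\<star> \<otimes> (y (ix b) \<otimes> b) = \<^bold>0"
      (* In one component the orthogonal domains a and b decide, in two the central idempotents. *)
      proof (cases "ix a = ix b")
        case True
        define d where "d = (y (ix b))\<^sup>\<star> \<otimes> y (ix b)"
        have d: "d \<in> E"
          using yi ix b by (simp add: d_def)
        have "(y (ix a) \<otimes> a)\<^sup>\<star> \<otimes> (y (ix b) \<otimes> b) = a \<otimes> (d \<otimes> b)"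
          using True yi ix a b by (simp add: d_def sinv_mult mult_assoc)
        also have "\<dots> = \<^bold>0"
          using idem_left_commute[of a d b] a b d atoms_orthogonal[of a b] by simp
        finally show ?thesis .
      next
        case False
        note ya = yi[OF ix(1)[OF a]] and yb = yi[OF ix(1)[OF b(1)]]
        have "(y (ix a))\<^sup>\<star> \<otimes> y (ix b) = (e (ix a) \<otimes> y (ix a))\<^sup>\<star> \<otimes> (e (ix b) \<otimes> y (ix b))"
          by (simp only: ya yb)
        also have "\<dots> = (y (ix a))\<^sup>\<star> \<otimes> ((e (ix a) \<otimes> e (ix b)) \<otimes> y (ix b))"
          using ya(1) yb(1) ix a b by (simp add: sinv_mult mult_assoc)
        also have "\<dots> = \<^bold>0"
          using ya(1) yb(1) e_orth[OF ix(1)[OF a] ix(1)[OF b(1)] False] by simp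
        finally have "a \<otimes> ((y (ix a))\<^sup>\<star> \<otimes> y (ix b)) \<otimes> b = \<^bold>0"
          using a b by simp
        then show ?thesis
          using a b ya(1) yb(1) by (simp add: sinv_mult mult_assoc)
      qed
    qed blast
    have "e i \<otimes> x = y i" if i: "i < k" for i
    proof (rule eq_if_atoms)
      fix a assume a: "a \<in> atoms"
      have "e i \<otimes> y i \<otimes> a = y i \<otimes> a"
        using yi[OF i] by simp
      then show "e i \<otimes> x \<otimes> a = y i \<otimes> a"
        using ez[OF i x a] ez[OF i yi(1)[OF i] a] xa[OF a] by (auto split: if_splits)
    qed (use i x yi in auto)
    then have "h x = y"
      using y by (auto simp: h_def PiE_iff extensional_def restrict_def)
    then show ?thesis
      using x by blast
  qed
  ultimately have "bij_betw h (carrier S) (carrier (product_group {..<k} T))"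
    using hom by (auto simp: bij_betw_def image_iff hom_def Pi_iff)
  then have "h \<in> iso S (product_group {..<k} T)"
    using hom by (simp add: iso_def)
  then have "S \<cong> product_group {..<k} T"
    by (auto simp: is_iso_def)
  moreover have "fully_group_matricial TYPE('a) (T i)" if "i < k" for i
    unfolding T_def using that fully_group_matricial_corner[OF CQ e ea] by simp
  ultimately show ?thesis
    unfolding finite_product_of_fully_group_matricial_def by blast
qed

end

theorem proposition4p6:
  fixes S :: "('a, 'm) monoid_scheme"
  assumes "boolean_inverse_monoid S"
  shows "(finite (idempotents S) \<longleftrightarrow>
      finite_product_of_fully_group_matricial TYPE('a) TYPE('a) S) \<and>
    (finite_product_of_fully_group_matricial TYPE('b) TYPE('g) S \<longrightarrow> finite (idempotents S))"
proof -
  have "finite_product_of_fully_group_matricial TYPE('a) TYPE('a) S" if "finite (idempotents S)"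
  proof -
    interpret finite_boolean_inverse_monoid S
      using assms that by (intro finite_boolean_inverse_monoid.intro
          finite_boolean_inverse_monoid_axioms.intro)
    show ?thesis
      by (rule product_of_corners)
  qed
  then show ?thesis
    by (intro conjI iffI impI) (auto intro: finite_idempotents_if_finite_product)
qed

end
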